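(* Consider a multi-layer SBM with $n$ nodes, $L$ layers and a fixed number $K$ of communities, with sparsity parameter $\rho$ and sampling probability $p\in(0,1]$, and let $\bar M$ and $\Pi$ be as defined in the context. Then: (i) If $\frac{\log(L+n)}{pnL^{1/2}}\lesssim\rho\lesssim\frac{1}{pn}$, then with probability larger than $1-O((L+n)^{-c_1})$ for some constant $c_1>0$, $$\|\bar M-\Pi\|_2\lesssim\max\Big\{\frac{\rho\log(L+n)}{p^{3/2}L^{1/2}},\ \rho^2\Big\}.$$ (ii) If $\rho\gtrsim\frac{\log(L+n)}{pn}$, then with probability larger than $1-O((L+n)^{-c_2})$ for some constant $c_2>0$, $$\|\bar M-\Pi\|_2\lesssim\max\Big\{\frac{n^{1/2}\rho^{3/2}\log^{1/2}(L+n)}{p^{1/2}L^{1/2}},\ \rho^2\Big\}.$$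
   Context: Multi-layer SBM: each node $i\in[n]$ has a label $g_i\in[K]$; $\Theta\in\{0,1\}^{n\times K}$ has $\Theta_{ik}=1$ iff $g_i=k$. For each layer $l$, $B_l=\rho B_{l,0}\in[0,1]^{K\times K}$ is symmetric, with $B_{l,0}$ having nonnegative entries bounded by an absolute constant. The $A_l\in\{0,1\}^{n\times n}$ are symmetric, independent across layers, $A_{l,ii}=0$, and $A_{l,ij}$ ($i<j$) independent $\mathrm{Bernoulli}(B_{l,g_ig_j})$. $P_l=\Theta B_l\Theta^T$ and $\Pi=\frac1L\sum_{l=1}^L P_l^2/n$. Random sampling: for each $l$ and each pair $i<j$, independently, with probability $p$ set $\tilde A_{l,ij}=A_{l,ij}/p$, otherwise $\tilde A_{l,ij}=0$; $\tilde A_{l,ji}=\tilde A_{l,ij}$, $\tilde A_{l,ii}=0$. Let $\tilde d_{l,i}=\#\{j:\tilde A_{l,ij}=1/p\}$, $\tilde D_l=\mathrm{diag}(\tilde d_{l,i})_i$, and $\bar M=\frac1L\sum_{l=1}^L\big(\frac{\tilde A_l^2}{n}-\frac{\tilde D_l}{np^2}\big)$. $\|\cdot\|_2$ is the spectral norm. $f\lesssim g$ means $f\le cg$ for a constant $c>0$ independent of $n,L,p,\rho$. *)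

theory Defs
  imports "HOL-Probability.Probability"
begin

text \<open>Multi-layer SBM with random edge sampling. Nodes are 0..n-1, layers 0..L-1,
  communities 0..K-1. Matrices are functions nat => nat => real, used on indices below n.\<close>

definition Theta :: "(nat \<Rightarrow> nat) \<Rightarrow> nat \<Rightarrow> nat \<Rightarrow> real" where
  "Theta g i k = (if g i = k then 1 else 0)"

definition Pmat :: "nat \<Rightarrow> (nat \<Rightarrow> nat) \<Rightarrow> (nat \<Rightarrow> nat \<Rightarrow> real) \<Rightarrow> nat \<Rightarrow> nat \<Rightarrow> real" where
  "Pmat K g Bl i j = (\<Sum>k<K. \<Sum>k'<K. Theta g i k * Bl k k' * Theta g j k')"

definition mmul :: "nat \<Rightarrow> (nat \<Rightarrow> nat \<Rightarrow> real) \<Rightarrow> (nat \<Rightarrow> nat \<Rightarrow> real) \<Rightarrow> nat \<Rightarrow> nat \<Rightarrow> real" where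
  "mmul n X Y i j = (\<Sum>k<n. X i k * Y k j)"

definition PiMat :: "nat \<Rightarrow> nat \<Rightarrow> nat \<Rightarrow> (nat \<Rightarrow> nat) \<Rightarrow> (nat \<Rightarrow> nat \<Rightarrow> nat \<Rightarrow> real) \<Rightarrow> real
    \<Rightarrow> nat \<Rightarrow> nat \<Rightarrow> real" where
  "PiMat n L K g B0 \<rho> i j =
     (1 / real L) * (\<Sum>l<L. mmul n (Pmat K g (\<lambda>k k'. \<rho> * B0 l k k')) (Pmat K g (\<lambda>k k'. \<rho> * B0 l k k')) i j / real n)"

definition spec_norm :: "nat \<Rightarrow> (nat \<Rightarrow> nat \<Rightarrow> real) \<Rightarrow> real" where
  "spec_norm n M = Sup {sqrt (\<Sum>i<n. (\<Sum>j<n. M i j * x j)\<^sup>2) | x. (\<Sum>i<n. (x i)\<^sup>2) = 1}"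

text \<open>Outcome space: for each layer l and pair i<j, a pair of booleans
  (edge indicator A_{l,ij}, sampling indicator). All coordinates are independent:
  A_{l,ij} ~ Bernoulli(rho * B0 l (g i) (g j)), sampled ~ Bernoulli(p).\<close>
type_synonym outcome = "nat \<times> nat \<times> nat \<Rightarrow> bool \<times> bool"

definition pair_index :: "nat \<Rightarrow> nat \<Rightarrow> (nat \<times> nat \<times> nat) set" where
  "pair_index n L = {(l, i, j). l < L \<and> i < j \<and> j < n}"

definition msbm_pmf :: "nat \<Rightarrow> nat \<Rightarrow> (nat \<Rightarrow> nat) \<Rightarrow> (nat \<Rightarrow> nat \<Rightarrow> nat \<Rightarrow> real) \<Rightarrow> real \<Rightarrow> real
    \<Rightarrow> outcome pmf" where
  "msbm_pmf n L g B0 \<rho> p =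
     Pi_pmf (pair_index n L) (False, False)
       (\<lambda>(l, i, j). pair_pmf (bernoulli_pmf (\<rho> * B0 l (g i) (g j))) (bernoulli_pmf p))"

definition tildeA_upper :: "real \<Rightarrow> outcome \<Rightarrow> nat \<Rightarrow> nat \<Rightarrow> nat \<Rightarrow> real" where
  "tildeA_upper p \<omega> l i j =
     (let A = (if fst (\<omega> (l, i, j)) then 1 else 0 :: real) in
      if snd (\<omega> (l, i, j)) then A / p else 0)"

definition tildeA :: "real \<Rightarrow> outcome \<Rightarrow> nat \<Rightarrow> nat \<Rightarrow> nat \<Rightarrow> real" where
  "tildeA p \<omega> l i j =
     (if i < j then tildeA_upper p \<omega> l i j
      else if j < i then tildeA_upper p \<omega> l j i else 0)"

definition tilde_deg :: "nat \<Rightarrow> real \<Rightarrow> outcome \<Rightarrow> nat \<Rightarrow> nat \<Rightarrow> nat" where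
  "tilde_deg n p \<omega> l i = card {j. j < n \<and> tildeA p \<omega> l i j = 1 / p}"

definition Mbar :: "nat \<Rightarrow> nat \<Rightarrow> real \<Rightarrow> outcome \<Rightarrow> nat \<Rightarrow> nat \<Rightarrow> real" where
  "Mbar n L p \<omega> i j =
     (1 / real L) * (\<Sum>l<L. mmul n (tildeA p \<omega> l) (tildeA p \<omega> l) i j / real n
        - (if i = j then real (tilde_deg n p \<omega> l i) else 0) / (real n * p\<^sup>2))"

definition msbm_valid :: "nat \<Rightarrow> real \<Rightarrow> nat \<Rightarrow> nat \<Rightarrow> (nat \<Rightarrow> nat) \<Rightarrow> (nat \<Rightarrow> nat \<Rightarrow> nat \<Rightarrow> real)
    \<Rightarrow> real \<Rightarrow> real \<Rightarrow> bool" where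
  "msbm_valid K C0 n L g B0 \<rho> p \<longleftrightarrow>
     1 \<le> n \<and> 1 \<le> L \<and> 0 < p \<and> p \<le> 1 \<and> 0 < \<rho> \<and>
     (\<forall>i<n. g i < K) \<and>
     (\<forall>l<L. \<forall>k<K. \<forall>k'<K. B0 l k k' = B0 l k' k \<and> 0 \<le> B0 l k k' \<and> B0 l k k' \<le> C0
        \<and> \<rho> * B0 l k k' \<le> 1)"

end

theory Submission
  imports Defs
begin

text \<open>
Write \<open>p * tildeA = H + p * P0\<close> with \<open>H\<close> centred and \<open>P0\<close> the off-diagonal part of the mean.
Subtracting the degrees removes exactly the diagonal of the squared matrices, so the error splits into
a deterministic part of size \<open>\<rho>\<^sup>2\<close>, the cross terms \<open>P0 H\<close> and \<open>H P0\<close>, and the off-diagonal part \<open>Y\<close>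
of the sum over the layers of \<open>H\<^sup>2\<close>. The cross terms are small entry by entry, so their Frobenius
norm suffices. For \<open>Y\<close> we bound the expected trace of \<open>Y ^ (2 * m)\<close> with \<open>m\<close> about \<open>ln (L + n)\<close>, a sum over
walks in which only those traversing each edge at least twice contribute. Such a walk of \<open>4 * m\<close> edges has at
most \<open>2 * m\<close> distinct ones, so for any \<open>\<alpha> \<ge> 1\<close> the weight \<open>v\<close> per distinct edge may be replaced by \<open>v / \<alpha>\<close>
at the total cost \<open>\<alpha> ^ (2 * m)\<close>. The weighted walks are then summed step by step: a step either
opens a new edge, at cost \<open>v / \<alpha>\<close>, or reuses one of at most \<open>4 * m\<close> old ones. The choice
\<open>\<alpha> \<approx> n v sqrt L / m\<close> balances both and gives \<open>\<parallel>Y\<parallel> \<lesssim> n v sqrt L ln (L + n)\<close>.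
\<close>

section \<open>Weighted counting of walks\<close>

text \<open>Sorting the endpoints sends both orientations of an undirected edge to the same
  coordinate of the outcome space. Traversing an edge again is then the same as repeating a letter
  of a word.\<close>

definition edge :: "nat \<Rightarrow> nat \<Rightarrow> nat \<Rightarrow> nat \<times> nat \<times> nat" where
  "edge l i j = (l, min i j, max i j)"

definition sym_mat :: "(nat \<times> nat \<times> nat \<Rightarrow> real) \<Rightarrow> nat \<Rightarrow> nat \<Rightarrow> nat \<Rightarrow> real" where
  "sym_mat h l i j = (if i = j then 0 else h (edge l i j))"

text \<open>The off-diagonal part of the sum of the squared noise matrices. The zero diagonal
  reflects the degree correction, and it makes the two edges of a contributing two-edge step
  distinct.\<close>

definition offdiag_gram :: "nat \<Rightarrow> nat \<Rightarrow> (nat \<times> nat \<times> nat \<Rightarrow> real) \<Rightarrow> nat \<Rightarrow> nat \<Rightarrow> real" where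
  "offdiag_gram n L h i j = (if i = j then 0 else \<Sum>l<L. mmul n (sym_mat h l) (sym_mat h l) i j)"

primrec mpow :: "nat \<Rightarrow> (nat \<Rightarrow> nat \<Rightarrow> real) \<Rightarrow> nat \<Rightarrow> nat \<Rightarrow> nat \<Rightarrow> real" where
  "mpow n M 0 = (\<lambda>i j. of_bool (i = j))"
| "mpow n M (Suc t) = mmul n M (mpow n M t)"

lemma edge_commute: "edge l i j = edge l j i"
  by (simp add: edge_def min.commute max.commute)

lemma edge_eq_iff: "edge l i j = edge l' i' j' \<longleftrightarrow> l = l' \<and> ((i = i' \<and> j = j') \<or> (i = j' \<and> j = i'))"
  by (auto simp: edge_def min_def max_def)

lemma edge_in_pair_index: "\<lbrakk>l < L; i < n; j < n; i \<noteq> j\<rbrakk> \<Longrightarrow> edge l i j \<in> pair_index n L"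
  by (auto simp: edge_def pair_index_def)

lemma finite_pair_index: "finite (pair_index n L)"
  by (rule finite_subset[of _ "{..<L} \<times> {..<n} \<times> {..<n}"]) (auto simp: pair_index_def)

lemma sum_of_bool_inj_le_card:
  assumes "finite A" "finite S" "inj_on f A"
  shows "(\<Sum>x\<in>A. of_bool (f x \<in> S)) \<le> real (card S)"
proof -
  have "(\<Sum>x\<in>A. of_bool (f x \<in> S)) = real (card {x\<in>A. f x \<in> S})"
    using assms(1) by (simp add: Int_def sum.If_cases of_bool_def)
  also have "card {x\<in>A. f x \<in> S} \<le> card S"
    using assms by (intro card_inj_on_le[of f]) (auto simp: inj_on_def)
  finally show ?thesis by simp
qed

text \<open>With the endpoint \<open>i\<close> fixed, \<open>(l, k)\<close> is determined by the
  edge, so each edge of \<open>S\<close> is counted at most once.\<close>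

lemma edge_count_le:
  assumes "finite S" "card S \<le> s"
  shows "(\<Sum>l<L. \<Sum>k<n. of_bool (edge l i k \<in> S)) \<le> real s"
proof -
  have "(\<Sum>l<L. \<Sum>k<n. of_bool (edge l i k \<in> S)) =
        (\<Sum>x\<in>{..<L}\<times>{..<n}. of_bool ((\<lambda>(l,k). edge l i k) x \<in> S) :: real)"
    by (simp only: sum.cartesian_product split_def fst_conv snd_conv)
  also have "\<dots> \<le> real (card S)"
    by (rule sum_of_bool_inj_le_card) (use assms in \<open>auto simp: inj_on_def edge_eq_iff\<close>)
  finally show ?thesis using assms(2) by linarith
qed

text \<open>Bounds the total weight of a two-edge step when \<open>s\<close> edges have been
  visited: the three summands are for both edges new, exactly one new, and both old.\<close>

definition walk_rate :: "nat \<Rightarrow> nat \<Rightarrow> real \<Rightarrow> nat \<Rightarrow> real" where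
  "walk_rate n L \<kappa> s = (real n)\<^sup>2 * real L * \<kappa>\<^sup>2 + 3 * real s * real n * \<kappa> + (real s)\<^sup>2"

lemma walk_rate_nonneg: "0 \<le> \<kappa> \<Longrightarrow> 0 \<le> walk_rate n L \<kappa> s"
  by (simp add: walk_rate_def)

lemma two_step_count_le:
  fixes \<kappa> :: real
  assumes S: "finite S" "card S \<le> s" and \<kappa>: "0 \<le> \<kappa>" and n: "1 \<le> n"
  shows "(\<Sum>j<n. \<Sum>l<L. \<Sum>k<n. (\<kappa> + of_bool (edge l i k \<in> S)) * (\<kappa> + of_bool (edge l k j \<in> S)))
         \<le> walk_rate n L \<kappa> s"
proof -
  let ?a = "\<lambda>l k. of_bool (edge l i k \<in> S) :: real" and ?b = "\<lambda>l k j. of_bool (edge l k j \<in> S) :: real"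
  let ?A = "\<Sum>l<L. \<Sum>k<n. ?a l k" and ?B = "\<Sum>j<n. \<Sum>l<L. \<Sum>k<n. ?b l k j"
  let ?C = "\<Sum>j<n. \<Sum>l<L. \<Sum>k<n. ?a l k * ?b l k j"
  have A: "?A \<le> real s" using edge_count_le[OF S] .
  \<comment> \<open>With neither endpoint fixed, an edge of \<open>S\<close> arises from both of its
    orientations; the boolean \<open>k \<le> j\<close> restores injectivity at the price of a factor
    2.\<close>
  have B: "?B \<le> 2 * real s"
  proof -
    have "?B = (\<Sum>x\<in>{..<n}\<times>{..<L}\<times>{..<n}.
        of_bool ((\<lambda>(j,l,k). (edge l k j, k \<le> j)) x \<in> S \<times> UNIV))"
      by (simp only: sum.cartesian_product split_def mem_Times_iff fst_conv snd_conv UNIV_I simp_thms)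
    also have "\<dots> \<le> real (card (S \<times> (UNIV :: bool set)))"
      by (rule sum_of_bool_inj_le_card) (use S in \<open>auto simp: inj_on_def edge_eq_iff\<close>)
    finally show ?thesis using S(2) by (simp add: card_cartesian_product)
  qed
  \<comment> \<open>Starting from the fixed \<open>i\<close>, the first edge determines
    \<open>l\<close> and \<open>k\<close>, and the second then determines \<open>j\<close>.\<close>
  have C: "?C \<le> (real s)\<^sup>2"
  proof -
    have "?C = (\<Sum>x\<in>{..<n}\<times>{..<L}\<times>{..<n}.
        of_bool ((\<lambda>(j,l,k). (edge l i k, edge l k j)) x \<in> S \<times> S))"
      by (simp only: sum.cartesian_product split_def mem_Times_iff fst_conv snd_conv of_bool_conj)
    also have "\<dots> \<le> real (card (S \<times> S))"
      by (rule sum_of_bool_inj_le_card) (use S in \<open>auto simp: inj_on_def edge_eq_iff\<close>)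
    also have "\<dots> = (real (card S))\<^sup>2" by (simp add: card_cartesian_product power2_eq_square)
    also have "\<dots> \<le> (real s)\<^sup>2" using S(2) by (intro power_mono) auto
    finally show ?thesis .
  qed
  have "(\<Sum>j<n. \<Sum>l<L. \<Sum>k<n. (\<kappa> + ?a l k) * (\<kappa> + ?b l k j))
      = (real n)\<^sup>2 * real L * \<kappa>\<^sup>2 + \<kappa> * (real n * ?A) + \<kappa> * ?B + ?C"
    by (simp add: distrib_left distrib_right sum.distrib sum_distrib_left[symmetric]
        sum_distrib_right[symmetric] power2_eq_square mult_ac)
  also have "\<dots> \<le> (real n)\<^sup>2 * real L * \<kappa>\<^sup>2 + \<kappa> * (real n * real s) + \<kappa> * (2 * real s) + (real s)\<^sup>2"
    using A B C \<kappa> by (intro add_mono mult_left_mono) auto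
  also have "\<kappa> * (2 * real s) \<le> \<kappa> * (2 * real s * real n)"
    using n \<kappa> by (intro mult_left_mono) (auto simp: mult_le_cancel_left1)
  finally show ?thesis by (simp add: walk_rate_def algebra_simps)
qed

text \<open>A new letter costs exactly \<kappa>, and an old one, which leaves the weight unchanged,
  is charged \<kappa> + 1. The weight of a word is thus bounded by a product over its letters, which
  can be summed one letter at a time.\<close>

lemma power_card_insert_le:
  fixes \<kappa> :: real
  assumes "finite S" "0 \<le> \<kappa>"
  shows "\<kappa> ^ card (insert e S) \<le> \<kappa> ^ card S * (\<kappa> + of_bool (e \<in> S))"
  using assms by (auto simp: card_insert_if insert_absorb algebra_simps)

text \<open>The hypothesis on \<open>h\<close> holds for independent centred variables bounded by \<open>1\<close> and of
  variance at most \<open>\<alpha> * \<kappa>\<close>: only words repeating every letter contribute, and the factor \<open>\<alpha> \<ge> 1\<close> turns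
  this restriction into a weight that can be summed one letter at a time.\<close>

locale repeated_moments =
  fixes M :: "'w pmf" and h :: "'w \<Rightarrow> nat \<times> nat \<times> nat \<Rightarrow> real"
    and n L :: nat and \<alpha> \<kappa> :: real
  assumes fin: "finite (set_pmf M)" and \<kappa>: "0 \<le> \<kappa>" and \<alpha>: "0 \<le> \<alpha>" and n: "1 \<le> n"
    and moment: "\<And>es r. \<lbrakk>set es \<subseteq> pair_index n L; length es = 2 * r\<rbrakk> \<Longrightarrow>
      \<bar>measure_pmf.expectation M (\<lambda>\<omega>. prod_list (map (h \<omega>) es))\<bar> \<le> \<alpha> ^ r * \<kappa> ^ card (set es)"
begin

abbreviation "E \<equiv> measure_pmf.expectation M"

lemma integrable [simp, intro]: "integrable (measure_pmf M) (f :: 'w \<Rightarrow> real)"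
  by (rule integrable_measure_pmf_finite[OF fin])

lemma expectation_sum: "E (\<lambda>\<omega>. \<Sum>x\<in>A. f x \<omega>) = (\<Sum>x\<in>A. E (f x))"
  for f :: "'b \<Rightarrow> 'w \<Rightarrow> real"
  by (rule Bochner_Integration.integral_sum) auto

lemma expectation_if:
  "E (\<lambda>\<omega>. if P then f \<omega> else 0) = (if P then E f else 0)"
  "E (\<lambda>\<omega>. if P then 0 else f \<omega>) = (if P then 0 else E f)"
  for f :: "'w \<Rightarrow> real"
  by simp_all

text \<open>The walk is read one step at a time, and \<open>es\<close> stores the letters read so
  far. As \<open>length es + 2 * t\<close> stays equal to \<open>2 * T\<close>, the moment
  hypothesis is applied only at the end, to a complete word, and every step sees at most
  \<open>2 * T\<close> old edges.\<close>

lemma expectation_mpow_le: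
  assumes "i < n" "set es \<subseteq> pair_index n L" "length es + 2 * t = 2 * T"
  shows "\<bar>E (\<lambda>\<omega>. prod_list (map (h \<omega>) es) * mpow n (offdiag_gram n L (h \<omega>)) t i j)\<bar>
         \<le> \<alpha> ^ T * \<kappa> ^ card (set es) * walk_rate n L \<kappa> (2 * T) ^ t"
  using assms
proof (induction t arbitrary: i es)
  case 0
  have "\<bar>E (\<lambda>\<omega>. prod_list (map (h \<omega>) es))\<bar> \<le> \<alpha> ^ T * \<kappa> ^ card (set es)"
    using 0 by (intro moment) auto
  moreover have "0 \<le> \<alpha> ^ T * \<kappa> ^ card (set es)" using \<alpha> \<kappa> by simp
  ultimately show ?case by (cases "i = j") simp_all
next
  case (Suc t)
  let ?Y = "\<lambda>\<omega>. offdiag_gram n L (h \<omega>)"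
  let ?f = "\<lambda>j' l k \<omega>. prod_list (map (h \<omega>) (edge l i k # edge l k j' # es)) * mpow n (?Y \<omega>) t j' j"
  let ?ok = "\<lambda>j' k. i \<noteq> j' \<and> i \<noteq> k \<and> k \<noteq> j'"
  let ?S = "set es" and ?R = "walk_rate n L \<kappa> (2 * T)"
  let ?w = "\<lambda>j' l k. (\<kappa> + of_bool (edge l i k \<in> ?S)) * (\<kappa> + of_bool (edge l k j' \<in> ?S))"
  \<comment> \<open>One factor of the power is expanded. The zero diagonals of
    \<open>offdiag_gram\<close> and \<open>sym_mat\<close> leave only triples \<open>i\<close>,
    \<open>k\<close>, \<open>j'\<close> of pairwise distinct nodes.\<close>
  have "E (\<lambda>\<omega>. prod_list (map (h \<omega>) es) * mpow n (?Y \<omega>) (Suc t) i j)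
      = E (\<lambda>\<omega>. \<Sum>j'<n. \<Sum>l<L. \<Sum>k<n. if ?ok j' k then ?f j' l k \<omega> else 0)"
  proof (intro arg_cong[of _ _ E] ext)
    fix \<omega>
    have "prod_list (map (h \<omega>) es) * (?Y \<omega> i j' * mpow n (?Y \<omega>) t j' j)
        = (\<Sum>l<L. \<Sum>k<n. if ?ok j' k then ?f j' l k \<omega> else 0)" for j'
      by (auto simp: offdiag_gram_def mmul_def sym_mat_def sum_distrib_left sum_distrib_right mult_ac
          intro!: sum.cong)
    then show "prod_list (map (h \<omega>) es) * mpow n (?Y \<omega>) (Suc t) i j
        = (\<Sum>j'<n. \<Sum>l<L. \<Sum>k<n. if ?ok j' k then ?f j' l k \<omega> else 0)"
      by (simp add: mmul_def sum_distrib_left)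
  qed
  also have "\<dots> = (\<Sum>j'<n. \<Sum>l<L. \<Sum>k<n. if ?ok j' k then E (?f j' l k) else 0)"
    by (simp only: expectation_sum expectation_if)
  finally have "\<bar>E (\<lambda>\<omega>. prod_list (map (h \<omega>) es) * mpow n (?Y \<omega>) (Suc t) i j)\<bar>
      \<le> (\<Sum>j'<n. \<Sum>l<L. \<Sum>k<n. \<bar>if ?ok j' k then E (?f j' l k) else 0\<bar>)"
    by (elim ssubst) ((rule order.trans[OF sum_abs], rule sum_mono)+, rule order.refl)
  also have "\<dots> \<le> (\<Sum>j'<n. \<Sum>l<L. \<Sum>k<n. \<alpha> ^ T * \<kappa> ^ card ?S * ?R ^ t * ?w j' l k)"
  proof (intro sum_mono)
    fix j' l k assume *: "j' \<in> {..<n}" "l \<in> {..<L}" "k \<in> {..<n}"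
    have nn: "0 \<le> \<alpha> ^ T * \<kappa> ^ card ?S * ?R ^ t * ?w j' l k"
      using \<alpha> \<kappa> walk_rate_nonneg[OF \<kappa>] by simp
    show "\<bar>if ?ok j' k then E (?f j' l k) else 0\<bar> \<le> \<alpha> ^ T * \<kappa> ^ card ?S * ?R ^ t * ?w j' l k"
    proof (cases "?ok j' k")
      case True
      \<comment> \<open>The two edges of a step differ because \<open>i \<noteq> j'\<close>, so
        whether the first one is old can be decided from \<open>es\<close> alone.\<close>
      have "edge l i k \<in> insert (edge l k j') ?S \<longleftrightarrow> edge l i k \<in> ?S"
        using True by (auto simp: edge_eq_iff)
      then have "\<kappa> ^ card (set (edge l i k # edge l k j' # es))
          \<le> \<kappa> ^ card (insert (edge l k j') ?S) * (\<kappa> + of_bool (edge l i k \<in> ?S))"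
        using \<kappa> power_card_insert_le[of "insert (edge l k j') ?S" \<kappa> "edge l i k"] by simp
      also have "\<kappa> ^ card (insert (edge l k j') ?S) * (\<kappa> + of_bool (edge l i k \<in> ?S))
          \<le> \<kappa> ^ card ?S * (\<kappa> + of_bool (edge l k j' \<in> ?S)) * (\<kappa> + of_bool (edge l i k \<in> ?S))"
        using \<kappa> by (intro mult_right_mono power_card_insert_le) auto
      also have "\<dots> = \<kappa> ^ card ?S * ?w j' l k"
        by (simp only: mult_ac)
      finally have "\<alpha> ^ T * \<kappa> ^ card (set (edge l i k # edge l k j' # es)) * ?R ^ t
          \<le> \<alpha> ^ T * (\<kappa> ^ card ?S * ?w j' l k) * ?R ^ t"
        using \<alpha> walk_rate_nonneg[OF \<kappa>] by (intro mult_right_mono mult_left_mono) auto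
      moreover have "\<bar>E (?f j' l k)\<bar> \<le> \<alpha> ^ T * \<kappa> ^ card (set (edge l i k # edge l k j' # es)) * ?R ^ t"
        using True * Suc.prems by (intro Suc.IH) (auto simp: edge_in_pair_index)
      ultimately have "\<bar>E (?f j' l k)\<bar> \<le> \<alpha> ^ T * (\<kappa> ^ card ?S * ?w j' l k) * ?R ^ t"
        by (rule order.trans[rotated])
      also have "\<dots> = \<alpha> ^ T * \<kappa> ^ card ?S * ?R ^ t * ?w j' l k"
        by (simp only: mult_ac)
      finally show ?thesis using True by (simp only: simp_thms if_True)
    qed (use nn in auto)
  qed
  also have "\<dots> = \<alpha> ^ T * \<kappa> ^ card ?S * ?R ^ t * (\<Sum>j'<n. \<Sum>l<L. \<Sum>k<n. ?w j' l k)"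
    by (simp add: sum_distrib_left)
  \<comment> \<open>The number of old edges is at most the length of \<open>es\<close>, hence at
    most \<open>2 * T\<close>.\<close>
  also have "\<dots> \<le> \<alpha> ^ T * \<kappa> ^ card ?S * ?R ^ t * ?R"
    using \<alpha> \<kappa> n walk_rate_nonneg[OF \<kappa>, of n L "2 * T"]
      order.trans[OF card_length[of es], of "2 * T"] Suc.prems(3)
    by (intro mult_left_mono two_step_count_le) auto
  finally show ?case by (simp add: mult_ac)
qed

lemma expectation_trace_mpow_le:
  "E (\<lambda>\<omega>. \<Sum>i<n. mpow n (offdiag_gram n L (h \<omega>)) T i i) \<le> real n * (\<alpha> * walk_rate n L \<kappa> (2 * T)) ^ T"
proof -
  have "E (\<lambda>\<omega>. \<Sum>i<n. mpow n (offdiag_gram n L (h \<omega>)) T i i)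
      = (\<Sum>i<n. E (\<lambda>\<omega>. mpow n (offdiag_gram n L (h \<omega>)) T i i))"
    by (rule expectation_sum)
  also have "\<dots> \<le> (\<Sum>i<n. (\<alpha> * walk_rate n L \<kappa> (2 * T)) ^ T)"
  proof (intro sum_mono)
    fix i assume "i \<in> {..<n}"
    then show "E (\<lambda>\<omega>. mpow n (offdiag_gram n L (h \<omega>)) T i i) \<le> (\<alpha> * walk_rate n L \<kappa> (2 * T)) ^ T"
      using expectation_mpow_le[of i "[]" T T i] by (simp add: power_mult_distrib)
  qed
  finally show ?thesis by simp
qed

text \<open>The same peeling for powers of a linear form in the column \<open>j\<close>, as needed
  for the cross terms. Each factor contributes one edge at \<open>j\<close>: the \<kappa>-part of
  the charge sums to \<open>n * L * \<kappa>\<close>, and at most \<open>2 * m\<close> edges are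
  old.\<close>

lemma expectation_linear_form_le:
  assumes "j < n" "0 \<le> b" "\<And>l k. l < L \<Longrightarrow> k < n \<Longrightarrow> \<bar>c l k\<bar> \<le> b"
    and "set es \<subseteq> pair_index n L" "length es + t = 2 * m"
  shows "\<bar>E (\<lambda>\<omega>. prod_list (map (h \<omega>) es) * (\<Sum>l<L. \<Sum>k<n. c l k * sym_mat (h \<omega>) l k j) ^ t)\<bar>
         \<le> \<alpha> ^ m * \<kappa> ^ card (set es) * (b * (real n * real L * \<kappa> + 2 * real m)) ^ t"
  using assms(4,5)
proof (induction t arbitrary: es)
  case 0
  then show ?case using moment[of es m] by simp
next
  case (Suc t)
  let ?G = "\<lambda>\<omega>. \<Sum>l<L. \<Sum>k<n. c l k * sym_mat (h \<omega>) l k j"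
  let ?f = "\<lambda>l k \<omega>. prod_list (map (h \<omega>) (edge l k j # es)) * ?G \<omega> ^ t"
  let ?S = "set es" and ?R = "b * (real n * real L * \<kappa> + 2 * real m)"
  have R: "0 \<le> ?R" using assms(2) \<kappa> by simp
  have "E (\<lambda>\<omega>. prod_list (map (h \<omega>) es) * ?G \<omega> ^ Suc t)
      = E (\<lambda>\<omega>. \<Sum>l<L. \<Sum>k<n. if k = j then 0 else c l k * ?f l k \<omega>)"
  proof (intro arg_cong[of _ _ E] ext)
    fix \<omega>
    have "prod_list (map (h \<omega>) es) * ?G \<omega> ^ Suc t = ?G \<omega> * (prod_list (map (h \<omega>) es) * ?G \<omega> ^ t)"
      by (simp add: mult_ac)
    also have "\<dots> = (\<Sum>l<L. \<Sum>k<n. c l k * sym_mat (h \<omega>) l k j * (prod_list (map (h \<omega>) es) * ?G \<omega> ^ t))"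
      by (simp only: sum_distrib_right)
    also have "\<dots> = (\<Sum>l<L. \<Sum>k<n. if k = j then 0 else c l k * ?f l k \<omega>)"
      by (intro sum.cong refl) (simp add: sym_mat_def)
    finally show "prod_list (map (h \<omega>) es) * ?G \<omega> ^ Suc t = \<dots>" .
  qed
  also have "\<dots> = (\<Sum>l<L. \<Sum>k<n. if k = j then 0 else c l k * E (?f l k))"
    by (simp only: expectation_sum expectation_if Bochner_Integration.integral_mult_right_zero)
  finally have "\<bar>E (\<lambda>\<omega>. prod_list (map (h \<omega>) es) * ?G \<omega> ^ Suc t)\<bar> \<le> (\<Sum>l<L. \<Sum>k<n. \<bar>if k = j then 0 else c l k * E (?f l k)\<bar>)"
    by (elim ssubst) ((rule order.trans[OF sum_abs], rule sum_mono)+, rule order.refl)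
  also have "\<dots> \<le> (\<Sum>l<L. \<Sum>k<n. b * (\<alpha> ^ m * \<kappa> ^ card ?S * ?R ^ t * (\<kappa> + of_bool (edge l j k \<in> ?S))))"
  proof (intro sum_mono)
    fix l k assume *: "l \<in> {..<L}" "k \<in> {..<n}"
    have nn: "0 \<le> b * (\<alpha> ^ m * \<kappa> ^ card ?S * ?R ^ t * (\<kappa> + of_bool (edge l j k \<in> ?S)))"
      using \<alpha> \<kappa> R assms(2) by simp
    show "\<bar>if k = j then 0 else c l k * E (?f l k)\<bar>
        \<le> b * (\<alpha> ^ m * \<kappa> ^ card ?S * ?R ^ t * (\<kappa> + of_bool (edge l j k \<in> ?S)))"
    proof (cases "k = j")
      case False
      have "\<kappa> ^ card (set (edge l k j # es)) \<le> \<kappa> ^ card ?S * (\<kappa> + of_bool (edge l k j \<in> ?S))"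
        using \<kappa> by (simp only: list.set, intro power_card_insert_le) auto
      then have "\<alpha> ^ m * \<kappa> ^ card (set (edge l k j # es)) * ?R ^ t
          \<le> \<alpha> ^ m * (\<kappa> ^ card ?S * (\<kappa> + of_bool (edge l k j \<in> ?S))) * ?R ^ t"
        using \<alpha> R by (intro mult_right_mono mult_left_mono) auto
      moreover have "\<bar>E (?f l k)\<bar> \<le> \<alpha> ^ m * \<kappa> ^ card (set (edge l k j # es)) * ?R ^ t"
        using False * Suc.prems assms(1) by (intro Suc.IH) (auto simp: edge_in_pair_index)
      ultimately have "\<bar>E (?f l k)\<bar> \<le> \<alpha> ^ m * (\<kappa> ^ card ?S * (\<kappa> + of_bool (edge l k j \<in> ?S))) * ?R ^ t"
        by (rule order.trans[rotated])
      also have "\<dots> = \<alpha> ^ m * \<kappa> ^ card ?S * ?R ^ t * (\<kappa> + of_bool (edge l j k \<in> ?S))"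
        by (simp only: mult_ac edge_commute[of l k j])
      finally have "\<bar>E (?f l k)\<bar> \<le> \<alpha> ^ m * \<kappa> ^ card ?S * ?R ^ t * (\<kappa> + of_bool (edge l j k \<in> ?S))" .
      then have "\<bar>c l k\<bar> * \<bar>E (?f l k)\<bar>
          \<le> b * (\<alpha> ^ m * \<kappa> ^ card ?S * ?R ^ t * (\<kappa> + of_bool (edge l j k \<in> ?S)))"
        using * assms(2,3) by (intro mult_mono) auto
      then show ?thesis using False by (simp only: abs_mult if_False)
    qed (use nn in auto)
  qed
  also have "\<dots> = \<alpha> ^ m * \<kappa> ^ card ?S * ?R ^ t *
      (b * (real n * real L * \<kappa> + (\<Sum>l<L. \<Sum>k<n. of_bool (edge l j k \<in> ?S))))"
    by (simp only: sum_distrib_left[symmetric] sum.distrib) (simp add: mult_ac)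
  also have "\<dots> \<le> \<alpha> ^ m * \<kappa> ^ card ?S * ?R ^ t * ?R"
    using \<alpha> \<kappa> R assms(2) edge_count_le[of ?S "2 * m" j n L]
      order.trans[OF card_length[of es], of "2 * m"] Suc.prems(2)
    by (intro mult_left_mono add_left_mono) auto
  finally show ?case by (simp add: mult_ac)
qed

lemma expectation_even_power_linear_form_le:
  assumes "j < n" "0 \<le> b" "\<And>l k. l < L \<Longrightarrow> k < n \<Longrightarrow> \<bar>c l k\<bar> \<le> b"
  shows "E (\<lambda>\<omega>. (\<Sum>l<L. \<Sum>k<n. c l k * sym_mat (h \<omega>) l k j) ^ (2 * m))
         \<le> (\<alpha> * (b * (real n * real L * \<kappa> + 2 * real m))\<^sup>2) ^ m"
  using expectation_linear_form_le[OF assms, where es = "[]" and t = "2 * m" and m = m]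
  by (simp add: power_mult_distrib power_mult)

end

section \<open>Traces of powers and the spectral norm\<close>

lemma mpow_add:
  assumes "i < n"
  shows "mpow n M (s + t) i j = (\<Sum>k<n. mpow n M s i k * mpow n M t k j)"
  using assms
proof (induction s arbitrary: i)
  case 0
  have "(\<Sum>k<n. of_bool (i = k) * mpow n M t k j) = (\<Sum>k<n. if k = i then mpow n M t k j else 0)"
    by (rule sum.cong) auto
  then show ?case using 0 by simp
next
  case (Suc s)
  have "mpow n M (Suc s + t) i j = (\<Sum>k'<n. \<Sum>k<n. M i k' * (mpow n M s k' k * mpow n M t k j))"
    using Suc by (simp add: mmul_def sum_distrib_left)
  also have "\<dots> = (\<Sum>k<n. \<Sum>k'<n. M i k' * (mpow n M s k' k * mpow n M t k j))"
    by (rule sum.swap)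
  finally show ?case by (simp add: mmul_def sum_distrib_right mult.assoc)
qed

lemma mpow_one: "j < n \<Longrightarrow> mpow n M (Suc 0) i j = M i j"
proof -
  assume "j < n"
  have "(\<Sum>k<n. M i k * of_bool (k = j)) = (\<Sum>k<n. if k = j then M i k else 0)"
    by (rule sum.cong) auto
  then show ?thesis using \<open>j < n\<close> by (simp add: mmul_def)
qed

lemma mpow_sym:
  assumes sym: "\<And>i j. i < n \<Longrightarrow> j < n \<Longrightarrow> M i j = M j i" and "i < n" "j < n"
  shows "mpow n M t i j = mpow n M t j i"
  using assms(2,3)
proof (induction t arbitrary: i j)
  case (Suc t)
  have "mpow n M (Suc t) i j = (\<Sum>k<n. mpow n M t j k * mpow n M 1 k i)"
    unfolding mpow.simps(2) mmul_def One_nat_def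
  proof (intro sum.cong refl)
    fix k assume "k \<in> {..<n}"
    then show "M i k * mpow n M t k j = mpow n M t j k * (\<Sum>k'<n. M k k' * mpow n M 0 k' i)"
      using Suc mpow_one[of i n M k] sym[of i k] by (simp add: mmul_def)
  qed
  also have "\<dots> = mpow n M (Suc t) j i"
    using mpow_add[of j n M t 1 i] Suc.prems by simp
  finally show ?case .
qed auto

text \<open>For symmetric \<open>M\<close> the trace of an even power is the squared Frobenius norm
  of the half power. It therefore dominates the norms of the iterates on unit vectors, and it is
  nonnegative, as Markov's inequality requires.\<close>

lemma trace_mpow_double:
  assumes sym: "\<And>i j. i < n \<Longrightarrow> j < n \<Longrightarrow> M i j = M j i"
  shows "(\<Sum>i<n. mpow n M (2 * t) i i) = (\<Sum>i<n. \<Sum>j<n. (mpow n M t i j)\<^sup>2)"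
proof (intro sum.cong refl)
  fix i assume i: "i \<in> {..<n}"
  then have "mpow n M (2 * t) i i = (\<Sum>j<n. mpow n M t i j * mpow n M t j i)"
    unfolding mult_2 by (intro mpow_add) auto
  also have "\<dots> = (\<Sum>j<n. (mpow n M t i j)\<^sup>2)"
    using i mpow_sym[OF sym, where t = t and j = i] by (intro sum.cong refl) (simp add: power2_eq_square)
  finally show "mpow n M (2 * t) i i = (\<Sum>j<n. (mpow n M t i j)\<^sup>2)" .
qed

lemma L2_set_Cauchy_Schwarz: "(\<Sum>i\<in>A. f i * g i) \<le> L2_set f A * L2_set g A"
  by (rule order.trans[OF _ L2_set_mult_ineq]) (auto intro!: sum_mono simp: abs_mult[symmetric])

lemma L2_set_power2: "(L2_set f A)\<^sup>2 = (\<Sum>i\<in>A. (f i)\<^sup>2)"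
  by (simp add: L2_set_def sum_nonneg)

text \<open>For symmetric \<open>M\<close> the norms of the iterates \<open>M ^ t x\<close> are log-convex in \<open>t\<close>.\<close>

lemma quadratic_power_le_trace_mpow:
  assumes sym: "\<And>i j. i < n \<Longrightarrow> j < n \<Longrightarrow> M i j = M j i" and x: "(\<Sum>i<n. (x i)\<^sup>2) = 1"
  shows "(L2_set (\<lambda>i. \<Sum>j<n. M i j * x j) {..<n}) ^ (2 * t) \<le> (\<Sum>i<n. mpow n M (2 * t) i i)"
proof -
  define u where "u t i = (\<Sum>j<n. mpow n M t i j * x j)" for t i
  define r where "r t = L2_set (u t) {..<n}" for t
  have u_Suc: "u (Suc t) i = (\<Sum>k<n. M i k * u t k)" for t i
  proof -
    have "u (Suc t) i = (\<Sum>j<n. \<Sum>k<n. M i k * (mpow n M t k j * x j))"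
      by (simp add: u_def mmul_def sum_distrib_right mult.assoc)
    also have "\<dots> = (\<Sum>k<n. \<Sum>j<n. M i k * (mpow n M t k j * x j))"
      by (rule sum.swap)
    finally show ?thesis by (simp add: u_def sum_distrib_left)
  qed
  have "(\<Sum>j<n. of_bool (i = j) * x j) = (\<Sum>j<n. if j = i then x j else 0)" for i
    by (rule sum.cong) auto
  then have u0: "u 0 i = x i" if "i < n" for i
    using that by (simp add: u_def)
  have r0: "r 0 = 1"
    using x u0 by (simp add: r_def L2_set_def)
  \<comment> \<open>Symmetry moves one factor \<open>M\<close> to the other side of the inner
    product of \<open>u (Suc t)\<close> with \<open>M\<close> applied to \<open>u t\<close>;
    Cauchy-Schwarz does the rest.\<close>
  have convex: "(r (Suc t))\<^sup>2 \<le> r t * r (Suc (Suc t))" for t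
  proof -
    have "(r (Suc t))\<^sup>2 = (\<Sum>i<n. u (Suc t) i * (\<Sum>k<n. M i k * u t k))"
      unfolding r_def L2_set_power2 by (simp only: power2_eq_square u_Suc)
    also have "\<dots> = (\<Sum>i<n. \<Sum>k<n. u t k * (M k i * u (Suc t) i))"
      unfolding sum_distrib_left
    proof (intro sum.cong refl)
      fix i k assume "i \<in> {..<n}" "k \<in> {..<n}"
      then have "M i k = M k i" by (intro sym) auto
      then show "u (Suc t) i * (M i k * u t k) = u t k * (M k i * u (Suc t) i)" by (simp only: mult_ac)
    qed
    also have "\<dots> = (\<Sum>k<n. \<Sum>i<n. u t k * (M k i * u (Suc t) i))"
      by (rule sum.swap)
    also have "\<dots> = (\<Sum>k<n. u t k * u (Suc (Suc t)) k)"
      by (simp only: u_Suc[of "Suc t"] sum_distrib_left)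
    also have "\<dots> \<le> r t * r (Suc (Suc t))"
      unfolding r_def by (rule L2_set_Cauchy_Schwarz)
    finally show ?thesis .
  qed
  have nn: "0 \<le> r t" for t by (simp add: r_def)
  \<comment> \<open>By log-convexity the ratios of consecutive norms do not decrease, so they stay
    above the first one, which is \<open>r 1\<close> because \<open>r 0 = 1\<close>. If
    \<open>r t\<close> vanishes, so does \<open>r (Suc t)\<close>.\<close>
  have growth: "r 1 * r t \<le> r (Suc t)" for t
  proof (induction t)
    case 0 then show ?case by (simp add: r0)
  next
    case (Suc t)
    show ?case
    proof (cases "r t = 0")
      case True
      then have "r (Suc t) = 0" using convex[of t] by simp
      then show ?thesis using nn by simp
    next
      case False
      then have pos: "0 < r t" using nn[of t] by simp
      have "r t * (r 1 * r (Suc t)) = (r 1 * r t) * r (Suc t)" by simp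
      also have "\<dots> \<le> r (Suc t) * r (Suc t)" using Suc nn by (intro mult_right_mono) auto
      also have "\<dots> \<le> r t * r (Suc (Suc t))" using convex[of t] by (simp add: power2_eq_square)
      finally show ?thesis using pos by simp
    qed
  qed
  have pow: "r 1 ^ t \<le> r t" for t
  proof (induction t)
    case (Suc t)
    then have "r 1 * r 1 ^ t \<le> r 1 * r t" using nn by (intro mult_left_mono) auto
    then show ?case using growth[of t] by simp
  qed (simp add: r0)
  have "r 1 = L2_set (\<lambda>i. \<Sum>j<n. M i j * x j) {..<n}"
    unfolding r_def by (intro L2_set_cong refl) (simp add: u_Suc u0)
  then have "(L2_set (\<lambda>i. \<Sum>j<n. M i j * x j) {..<n}) ^ (2 * t) = (r 1 ^ t)\<^sup>2"
    by (simp add: power_mult[symmetric] mult.commute)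
  also have "\<dots> \<le> (r t)\<^sup>2" using pow nn by (intro power_mono) auto
  also have "\<dots> = (\<Sum>i<n. (u t i)\<^sup>2)" by (simp add: r_def L2_set_power2)
  \<comment> \<open>Cauchy-Schwarz in each row: on a unit vector the norm is at most the Frobenius
    norm.\<close>
  also have "\<dots> \<le> (\<Sum>i<n. \<Sum>j<n. (mpow n M t i j)\<^sup>2)"
  proof (intro sum_mono)
    fix i
    have "\<bar>u t i\<bar> \<le> L2_set (mpow n M t i) {..<n} * L2_set x {..<n}"
      unfolding u_def by (rule order.trans[OF sum_abs]) (simp only: abs_mult L2_set_mult_ineq)
    also have "L2_set x {..<n} = 1" using x by (simp add: L2_set_def)
    finally have "\<bar>u t i\<bar> \<le> L2_set (mpow n M t i) {..<n}" by simp
    then have "\<bar>u t i\<bar>\<^sup>2 \<le> (L2_set (mpow n M t i) {..<n})\<^sup>2" by (intro power_mono) auto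
    then show "(u t i)\<^sup>2 \<le> (\<Sum>j<n. (mpow n M t i j)\<^sup>2)" by (simp add: L2_set_power2)
  qed
  finally show ?thesis by (simp only: trace_mpow_double[OF sym])
qed

lemma spec_norm_le:
  assumes "1 \<le> n"
    and "\<And>x. (\<Sum>i<n. (x i)\<^sup>2) = 1 \<Longrightarrow> L2_set (\<lambda>i. \<Sum>j<n. M i j * x j) {..<n} \<le> c"
  shows "spec_norm n M \<le> c"
  unfolding spec_norm_def
proof (rule cSup_least)
  \<comment> \<open>The least-upper-bound rule on the reals needs a nonempty set; the first basis
    vector is a unit vector since \<open>1 \<le> n\<close>.\<close>
  have "(\<Sum>i<n. (of_bool (i = 0) :: real)\<^sup>2) = (\<Sum>i<n. if i = 0 then 1 else 0)"
    by (rule sum.cong) auto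
  also have "\<dots> = 1" using assms(1) by simp
  finally have "\<exists>x :: nat \<Rightarrow> real. (\<Sum>i<n. (x i)\<^sup>2) = 1"
    by (intro exI[of _ "\<lambda>i. of_bool (i = 0)"])
  then show "{sqrt (\<Sum>i<n. (\<Sum>j<n. M i j * x j)\<^sup>2) |x. (\<Sum>i<n. (x i)\<^sup>2) = 1} \<noteq> {}"
    by simp
qed (use assms(2) in \<open>auto simp: L2_set_def\<close>)

text \<open>The Frobenius bound: Cauchy-Schwarz within a row gives a factor \<open>sqrt n\<close>,
  and the \<open>n\<close> rows give another.\<close>

lemma entrywise_bound_L2_set:
  assumes "\<And>i j. i < n \<Longrightarrow> j < n \<Longrightarrow> \<bar>M i j\<bar> \<le> b" "0 \<le> b" "(\<Sum>i<n. (x i)\<^sup>2) = 1"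
  shows "L2_set (\<lambda>i. \<Sum>j<n. M i j * x j) {..<n} \<le> real n * b"
proof -
  have "\<bar>\<Sum>j<n. M i j * x j\<bar> \<le> sqrt (real n) * b" if "i < n" for i
  proof -
    have "\<bar>\<Sum>j<n. M i j * x j\<bar> \<le> L2_set (M i) {..<n} * L2_set x {..<n}"
      by (rule order.trans[OF sum_abs]) (simp only: abs_mult L2_set_mult_ineq)
    also have "L2_set x {..<n} = 1" using assms(3) by (simp add: L2_set_def)
    also have "L2_set (M i) {..<n} = L2_set (\<lambda>j. \<bar>M i j\<bar>) {..<n}" by (simp add: L2_set_def)
    also have "\<dots> \<le> L2_set (\<lambda>j. b) {..<n}"
      using assms(1) that by (intro L2_set_mono) auto
    finally show ?thesis using assms(2) by (simp add: L2_set_constant)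
  qed
  then have "L2_set (\<lambda>i. \<bar>\<Sum>j<n. M i j * x j\<bar>) {..<n} \<le> L2_set (\<lambda>i. sqrt (real n) * b) {..<n}"
    by (intro L2_set_mono) auto
  also have "\<dots> = real n * b"
    using assms(2) by (simp add: L2_set_constant)
  finally show ?thesis by (simp add: L2_set_def)
qed

lemma diagonal_bound_L2_set:
  fixes n :: nat
  assumes "\<And>i. i < n \<Longrightarrow> \<bar>d i\<bar> \<le> b" "(\<Sum>i<n. (x i)\<^sup>2) = 1" "0 \<le> b"
  shows "L2_set (\<lambda>i. \<Sum>j<n. (if i = j then d i else 0) * x j) {..<n} \<le> b"
proof -
  have "(\<Sum>j<n. (if i = j then d i else 0) * x j) = d i * x i" if "i < n" for i
  proof -
    have "(\<Sum>j<n. (if i = j then d i else 0) * x j) = (\<Sum>j<n. if j = i then d i * x j else 0)"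
      by (rule sum.cong) auto
    also have "\<dots> = d i * x i" using that by (subst sum.delta) auto
    finally show ?thesis .
  qed
  then have "L2_set (\<lambda>i. \<Sum>j<n. (if i = j then d i else 0) * x j) {..<n} = L2_set (\<lambda>i. \<bar>d i\<bar> * \<bar>x i\<bar>) {..<n}"
    by (simp add: L2_set_def power_mult_distrib)
  also have "\<dots> \<le> L2_set (\<lambda>i. b * \<bar>x i\<bar>) {..<n}"
    using assms by (intro L2_set_mono mult_right_mono) auto
  also have "\<dots> = b * L2_set (\<lambda>i. \<bar>x i\<bar>) {..<n}"
    using assms(3) by (simp add: L2_set_right_distrib)
  also have "L2_set (\<lambda>i. \<bar>x i\<bar>) {..<n} = 1" using assms(2) by (simp add: L2_set_def)
  finally show ?thesis by simp
qed

section \<open>Moments of independent centred variables\<close>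

text \<open>Groups a word by its letters so that independence applies; letters of \<open>I\<close>
  that do not occur have exponent 0.\<close>

lemma prod_list_map_eq_prod_count:
  fixes f :: "'a \<Rightarrow> real"
  assumes "finite I" "set es \<subseteq> I"
  shows "prod_list (map f es) = (\<Prod>e\<in>I. f e ^ count_list es e)"
  using assms(2)
proof (induction es)
  case (Cons a es)
  have "(\<Prod>e\<in>I. f e ^ count_list (a # es) e)
      = (\<Prod>e\<in>I. (if e = a then f e else 1) * f e ^ count_list es e)"
    by (intro prod.cong) auto
  also have "\<dots> = f a * (\<Prod>e\<in>I. f e ^ count_list es e)"
    using Cons.prems assms(1) by (simp add: prod.distrib)
  finally show ?case using Cons by simp
qed simp

text \<open>Independence of the coordinates of a product distribution; finite supports supply the
  integrability that signed factors require.\<close>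

lemma signed_expectation_prod_Pi_pmf:
  fixes f :: "'a \<Rightarrow> 'b \<Rightarrow> real"
  assumes "finite I" "\<And>e. e \<in> I \<Longrightarrow> finite (set_pmf (D e))"
  shows "measure_pmf.expectation (Pi_pmf I dflt D) (\<lambda>\<omega>. \<Prod>e\<in>I. f e (\<omega> e))
       = (\<Prod>e\<in>I. measure_pmf.expectation (D e) (f e))"
proof -
  let ?M = "measure_pmf (Pi_pmf I dflt D)"
  have marg: "measure_pmf.expectation (Pi_pmf I dflt D) (\<lambda>\<omega>. f e (\<omega> e)) = measure_pmf.expectation (D e) (f e)"
    if "e \<in> I" for e
    using that assms(1) by (simp add: Pi_pmf_component flip: integral_map_pmf[of "\<lambda>\<omega>. \<omega> e"])
  have int: "integrable ?M (\<lambda>\<omega>. f e (\<omega> e))" if "e \<in> I" for e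
  proof -
    have "integrable (measure_pmf (map_pmf (\<lambda>\<omega>. \<omega> e) (Pi_pmf I dflt D))) (f e)"
      using assms that by (intro integrable_measure_pmf_finite) (auto simp: Pi_pmf_component)
    then show ?thesis by simp
  qed
  have "prob_space.indep_vars ?M (\<lambda>_. borel) (\<lambda>e. f e \<circ> (\<lambda>\<omega>. \<omega> e)) I"
    using indep_vars_Pi_pmf[OF assms(1)] by (rule prob_space.indep_vars_compose[OF measure_pmf.prob_space_axioms]) auto
  then have "measure_pmf.expectation (Pi_pmf I dflt D) (\<lambda>\<omega>. \<Prod>e\<in>I. f e (\<omega> e))
      = (\<Prod>e\<in>I. measure_pmf.expectation (Pi_pmf I dflt D) (\<lambda>\<omega>. f e (\<omega> e)))"
    using int by (intro prob_space.indep_vars_lebesgue_integral[OF measure_pmf.prob_space_axioms] assms(1))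
       (auto simp: o_def)
  then show ?thesis using marg by simp
qed

text \<open>A letter occurring exactly once makes the expectation vanish, by independence and mean
  zero. Otherwise every letter occurs at least twice, so there are at most \<open>r\<close> distinct
  ones, and \<alpha> to the number of distinct letters is at most
  \<open>\<alpha> ^ r\<close>.\<close>

lemma repeated_word_moment_le:
  fixes f :: "'a \<Rightarrow> 'b \<Rightarrow> real"
  assumes fin: "finite I" "\<And>e. e \<in> I \<Longrightarrow> finite (set_pmf (D e))"
    and mean: "\<And>e. e \<in> I \<Longrightarrow> measure_pmf.expectation (D e) (f e) = 0"
    and mom: "\<And>e c. e \<in> I \<Longrightarrow> 2 \<le> c \<Longrightarrow> \<bar>measure_pmf.expectation (D e) (\<lambda>y. f e y ^ c)\<bar> \<le> v"
    and v: "0 \<le> v" "1 \<le> \<alpha>" and es: "set es \<subseteq> I" "length es = 2 * r"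
  shows "\<bar>measure_pmf.expectation (Pi_pmf I dflt D) (\<lambda>\<omega>. prod_list (map (\<lambda>e. f e (\<omega> e)) es))\<bar>
       \<le> \<alpha> ^ r * (v / \<alpha>) ^ card (set es)"
proof -
  let ?c = "count_list es"
  have "measure_pmf.expectation (Pi_pmf I dflt D) (\<lambda>\<omega>. prod_list (map (\<lambda>e. f e (\<omega> e)) es))
      = measure_pmf.expectation (Pi_pmf I dflt D) (\<lambda>\<omega>. \<Prod>e\<in>I. f e (\<omega> e) ^ ?c e)"
    by (simp add: prod_list_map_eq_prod_count[OF fin(1) es(1)])
  also have "\<dots> = (\<Prod>e\<in>I. measure_pmf.expectation (D e) (\<lambda>y. f e y ^ ?c e))"
    by (rule signed_expectation_prod_Pi_pmf[OF fin])
  finally have eq: "\<bar>measure_pmf.expectation (Pi_pmf I dflt D) (\<lambda>\<omega>. prod_list (map (\<lambda>e. f e (\<omega> e)) es))\<bar>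
      = (\<Prod>e\<in>I. \<bar>measure_pmf.expectation (D e) (\<lambda>y. f e y ^ ?c e)\<bar>)"
    by (simp only: abs_prod)
  show ?thesis
  proof (cases "\<exists>e\<in>I. ?c e = 1")
    case True
    then obtain e where "e \<in> I" "?c e = 1" by blast
    then have "(\<Prod>e\<in>I. \<bar>measure_pmf.expectation (D e) (\<lambda>y. f e y ^ ?c e)\<bar>) = 0"
      using mean fin(1) by (intro prod_zero) (auto intro!: bexI[of _ e])
    then show ?thesis using eq v by simp
  next
    case False
    have c2: "2 \<le> ?c e" if "e \<in> set es" for e
    proof -
      have "?c e \<noteq> 0" using that by (simp add: count_list_0_iff)
      moreover have "?c e \<noteq> 1" using False that es(1) by auto
      ultimately show ?thesis by linarith
    qed
    have "(\<Prod>e\<in>I. \<bar>measure_pmf.expectation (D e) (\<lambda>y. f e y ^ ?c e)\<bar>) \<le> (\<Prod>e\<in>I. if e \<in> set es then v else 1)"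
      using mom c2 by (intro prod_mono) (auto simp: count_list_0_iff)
    also have "\<dots> = v ^ card (set es)"
      using fin(1) es(1) by (simp add: prod.If_cases Int_absorb1)
    also have "\<dots> = \<alpha> ^ card (set es) * (v / \<alpha>) ^ card (set es)"
      using v by (simp add: power_mult_distrib[symmetric])
    also have "\<dots> \<le> \<alpha> ^ r * (v / \<alpha>) ^ card (set es)"
    proof (intro mult_right_mono power_increasing)
      have "2 * card (set es) = (\<Sum>e\<in>set es. 2)" by simp
      also have "\<dots> \<le> (\<Sum>e\<in>set es. ?c e)" using c2 by (intro sum_mono) auto
      also have "\<dots> = 2 * r" using sum_count_set[of es "set es"] es by simp
      finally show "card (set es) \<le> r" by simp
    qed (use v in auto)
    finally show ?thesis using eq by simp
  qed
qed

text \<open>The conjunction of the two independent indicators is Bernoulli with parameter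
  \<open>p * q\<close>; the moments follow by summing over the four outcomes.\<close>

lemma bernoulli_centred_moment:
  assumes "0 \<le> q" "q \<le> 1" "0 \<le> p" "p \<le> 1"
  shows "measure_pmf.expectation (pair_pmf (bernoulli_pmf q) (bernoulli_pmf p))
      (\<lambda>y. (of_bool (fst y \<and> snd y) - p * q) ^ c) = p * q * (1 - p * q) ^ c + (1 - p * q) * (- (p * q)) ^ c"
    (is "?L = ?R")
proof -
  have "?L = (\<Sum>y\<in>UNIV. (of_bool (fst y \<and> snd y) - p * q) ^ c *
      pmf (pair_pmf (bernoulli_pmf q) (bernoulli_pmf p)) y)"
    by (rule integral_measure_pmf_real) auto
  also have "(UNIV :: (bool \<times> bool) set) = {(True, True), (True, False), (False, True), (False, False)}"
    by auto
  also have "(\<Sum>y\<in>\<dots>. (of_bool (fst y \<and> snd y) - p * q) ^ c *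
      pmf (pair_pmf (bernoulli_pmf q) (bernoulli_pmf p)) y) = ?R"
    using assms by (simp add: pmf_pair) (simp add: ring_distribs mult_ac)
  finally show ?thesis .
qed

lemma bernoulli_centred_moment_le:
  assumes "0 \<le> q" "q \<le> 1" "0 \<le> p" "p \<le> 1" "2 \<le> c"
  shows "\<bar>measure_pmf.expectation (pair_pmf (bernoulli_pmf q) (bernoulli_pmf p))
      (\<lambda>y. (of_bool (fst y \<and> snd y) - p * q) ^ c)\<bar> \<le> p * q"
proof -
  define \<mu> where "\<mu> = p * q"
  have \<mu>: "0 \<le> \<mu>" "\<mu> \<le> 1" using assms by (auto simp: \<mu>_def mult_le_one)
  have "\<bar>\<mu> * (1 - \<mu>) ^ c + (1 - \<mu>) * (- \<mu>) ^ c\<bar> \<le> \<mu> * (1 - \<mu>) ^ c + (1 - \<mu>) * \<mu> ^ c"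
    using \<mu> by (intro order.trans[OF abs_triangle_ineq]) (simp add: abs_mult power_abs)
  \<comment> \<open>Powers of numbers in the unit interval decrease, so the worst exponent is 2,
    where the bound becomes the variance \<open>\<mu> - \<mu> ^ 2\<close>.\<close>
  also have "\<dots> \<le> \<mu> * (1 - \<mu>) ^ 2 + (1 - \<mu>) * \<mu> ^ 2"
    using \<mu> assms(5) by (intro add_mono mult_left_mono power_decreasing) auto
  also have "\<dots> = \<mu> - \<mu> ^ 2" by (simp add: power2_eq_square algebra_simps)
  also have "\<dots> \<le> \<mu>" by simp
  finally show ?thesis using assms by (simp add: bernoulli_centred_moment \<mu>_def)
qed

section \<open>Tail bounds from high moments\<close>

lemma sym_mat_commute: "sym_mat h l i j = sym_mat h l j i"
  by (simp add: sym_mat_def edge_commute)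

lemma offdiag_gram_commute: "offdiag_gram n L h i j = offdiag_gram n L h j i"
proof -
  have "mmul n (sym_mat h l) (sym_mat h l) i j = mmul n (sym_mat h l) (sym_mat h l) j i" for l
    unfolding mmul_def
  proof (intro sum.cong refl)
    fix k
    show "sym_mat h l i k * sym_mat h l k j = sym_mat h l j k * sym_mat h l k i"
      by (simp only: sym_mat_commute[of h l i k] sym_mat_commute[of h l k j] mult.commute)
  qed
  then show ?thesis by (simp add: offdiag_gram_def)
qed

text \<open>A threshold \<open>exp 2\<close> times larger than the root of a moment bound turns
  Markov's inequality at the power \<open>2 * m\<close> into the decay
  \<open>exp (- 4 * m)\<close>.\<close>

lemma power_div_exp_mult_power:
  fixes Y :: real
  assumes "0 < Y"
  shows "Y ^ (2 * m) / (exp 2 * Y) ^ (2 * m) = exp (- 4 * real m)"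
  using assms by (simp add: power_mult_distrib exp_minus field_simps flip: exp_of_nat_mult)

text \<open>A unit vector that is stretched too much forces the trace of the power
  \<open>2 * m\<close> to be large, and Markov's inequality applies. Such a power reads
  \<open>4 * m\<close> edges, hence the argument of \<open>walk_rate\<close>.\<close>

lemma (in repeated_moments) prob_gram_large_le:
  assumes m: "1 \<le> m" and \<alpha>1: "1 \<le> \<alpha>"
  shows "measure_pmf.prob M {\<omega>. \<exists>x. (\<Sum>i<n. (x i)\<^sup>2) = 1 \<and>
      exp 2 * (\<alpha> * walk_rate n L \<kappa> (4 * m)) < L2_set (\<lambda>i. \<Sum>j<n. offdiag_gram n L (h \<omega>) i j * x j) {..<n}}
    \<le> real n * exp (- 4 * real m)"
proof -
  let ?Y = "\<alpha> * walk_rate n L \<kappa> (4 * m)"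
  let ?tr = "\<lambda>\<omega>. \<Sum>i<n. mpow n (offdiag_gram n L (h \<omega>)) (2 * m) i i"
  have "0 < walk_rate n L \<kappa> (4 * m)"
    using m \<kappa> unfolding walk_rate_def by (intro add_nonneg_pos) auto
  then have Y: "0 < ?Y" using \<alpha>1 by simp
  have "{\<omega>. \<exists>x. (\<Sum>i<n. (x i)\<^sup>2) = 1 \<and>
      exp 2 * ?Y < L2_set (\<lambda>i. \<Sum>j<n. offdiag_gram n L (h \<omega>) i j * x j) {..<n}}
      \<subseteq> {\<omega> \<in> space (measure_pmf M). (exp 2 * ?Y) ^ (2 * m) \<le> ?tr \<omega>}"
  proof safe
    fix \<omega> x assume x: "(\<Sum>i<n. (x i)\<^sup>2) = 1"
      and "exp 2 * ?Y < L2_set (\<lambda>i. \<Sum>j<n. offdiag_gram n L (h \<omega>) i j * x j) {..<n}"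
    then have "(exp 2 * ?Y) ^ (2 * m)
        \<le> (L2_set (\<lambda>i. \<Sum>j<n. offdiag_gram n L (h \<omega>) i j * x j) {..<n}) ^ (2 * m)"
      using Y by (intro power_mono) auto
    also have "\<dots> \<le> ?tr \<omega>"
      by (rule quadratic_power_le_trace_mpow[OF offdiag_gram_commute x])
    finally show "(exp 2 * ?Y) ^ (2 * m) \<le> ?tr \<omega>" .
  qed simp
  then have "measure_pmf.prob M {\<omega>. \<exists>x. (\<Sum>i<n. (x i)\<^sup>2) = 1 \<and>
      exp 2 * ?Y < L2_set (\<lambda>i. \<Sum>j<n. offdiag_gram n L (h \<omega>) i j * x j) {..<n}}
      \<le> measure_pmf.prob M {\<omega> \<in> space (measure_pmf M). (exp 2 * ?Y) ^ (2 * m) \<le> ?tr \<omega>}"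
    by (rule measure_pmf.finite_measure_mono) simp
  also have "\<dots> \<le> E ?tr / (exp 2 * ?Y) ^ (2 * m)"
  proof (rule integral_Markov_inequality_measure[where A = "{}"])
    show "AE \<omega> in measure_pmf M. 0 \<le> ?tr \<omega>"
      by (simp add: trace_mpow_double[OF offdiag_gram_commute] sum_nonneg)
  qed (use Y in auto)
  also have "\<dots> \<le> (real n * ?Y ^ (2 * m)) / (exp 2 * ?Y) ^ (2 * m)"
    using expectation_trace_mpow_le[of "2 * m"] Y by (intro divide_right_mono) auto
  also have "\<dots> = real n * exp (- 4 * real m)"
    by (simp only: times_divide_eq_right[symmetric] power_div_exp_mult_power[OF Y])
  finally show ?thesis .
qed

text \<open>One application of Markov's inequality to the sum of the \<open>2 * m\<close>-th powers
  over all \<open>i\<close> and \<open>j\<close> plays the part of a union bound, whence the factor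
  \<open>n\<close> squared.\<close>

lemma (in repeated_moments) prob_linear_large_le:
  assumes m: "1 \<le> m" and \<alpha>1: "1 \<le> \<alpha>" and b: "0 < b"
    and c: "\<And>i l k. i < n \<Longrightarrow> l < L \<Longrightarrow> k < n \<Longrightarrow> \<bar>c i l k\<bar> \<le> b"
  shows "measure_pmf.prob M {\<omega>. \<exists>i<n. \<exists>j<n.
      exp 2 * (sqrt \<alpha> * (b * (real n * real L * \<kappa> + 2 * real m)))
        < \<bar>\<Sum>l<L. \<Sum>k<n. c i l k * sym_mat (h \<omega>) l k j\<bar>}
    \<le> (real n)\<^sup>2 * exp (- 4 * real m)"
proof -
  let ?G = "\<lambda>i j \<omega>. \<Sum>l<L. \<Sum>k<n. c i l k * sym_mat (h \<omega>) l k j"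
  let ?Z = "sqrt \<alpha> * (b * (real n * real L * \<kappa> + 2 * real m))"
  let ?S = "\<lambda>\<omega>. \<Sum>i<n. \<Sum>j<n. ?G i j \<omega> ^ (2 * m)"
  have "0 < real n * real L * \<kappa> + 2 * real m"
    using m \<kappa> by (intro add_nonneg_pos) auto
  then have Z: "0 < ?Z" using \<alpha>1 b by simp
  then have eZ: "0 < exp 2 * ?Z" by (rule mult_pos_pos[OF exp_gt_zero])
  have Zpow: "?Z ^ (2 * m) = (\<alpha> * (b * (real n * real L * \<kappa> + 2 * real m))\<^sup>2) ^ m"
    using \<alpha>1 by (simp add: power_mult power_mult_distrib)
  have "{\<omega>. \<exists>i<n. \<exists>j<n. exp 2 * ?Z < \<bar>?G i j \<omega>\<bar>}
      \<subseteq> {\<omega> \<in> space (measure_pmf M). (exp 2 * ?Z) ^ (2 * m) \<le> ?S \<omega>}"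
  proof safe
    fix \<omega> i j assume ij: "i < n" "j < n" and "exp 2 * ?Z < \<bar>?G i j \<omega>\<bar>"
    then have "(exp 2 * ?Z) ^ (2 * m) \<le> \<bar>?G i j \<omega>\<bar> ^ (2 * m)"
      using eZ by (intro power_mono less_imp_le)
    also have "\<dots> = ?G i j \<omega> ^ (2 * m)" by (simp add: power_mult)
    also have "\<dots> \<le> (\<Sum>j<n. ?G i j \<omega> ^ (2 * m))"
      using ij by (intro member_le_sum[where f = "\<lambda>j. ?G i j \<omega> ^ (2 * m)"]) auto
    also have "\<dots> \<le> ?S \<omega>"
      using ij by (intro member_le_sum[where f = "\<lambda>i. \<Sum>j<n. ?G i j \<omega> ^ (2 * m)"]) (auto intro!: sum_nonneg)
    finally show "(exp 2 * ?Z) ^ (2 * m) \<le> ?S \<omega>" .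
  qed simp
  then have "measure_pmf.prob M {\<omega>. \<exists>i<n. \<exists>j<n. exp 2 * ?Z < \<bar>?G i j \<omega>\<bar>}
      \<le> measure_pmf.prob M {\<omega> \<in> space (measure_pmf M). (exp 2 * ?Z) ^ (2 * m) \<le> ?S \<omega>}"
    by (rule measure_pmf.finite_measure_mono) simp
  also have "\<dots> \<le> E ?S / (exp 2 * ?Z) ^ (2 * m)"
  proof (rule integral_Markov_inequality_measure[where A = "{}"])
    show "AE \<omega> in measure_pmf M. 0 \<le> ?S \<omega>"
      by (intro AE_I2 sum_nonneg) simp
    show "0 < (exp 2 * ?Z) ^ (2 * m)"
      by (rule zero_less_power[OF eZ])
  qed auto
  also have "E ?S = (\<Sum>i<n. \<Sum>j<n. E (\<lambda>\<omega>. ?G i j \<omega> ^ (2 * m)))"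
    by (simp only: expectation_sum)
  also have "\<dots> / (exp 2 * ?Z) ^ (2 * m) \<le> (\<Sum>i<n. \<Sum>j<n. ?Z ^ (2 * m)) / (exp 2 * ?Z) ^ (2 * m)"
  proof (intro divide_right_mono sum_mono)
    fix i j assume "i \<in> {..<n}" "j \<in> {..<n}"
    then show "E (\<lambda>\<omega>. ?G i j \<omega> ^ (2 * m)) \<le> ?Z ^ (2 * m)"
      unfolding Zpow using b c by (intro expectation_even_power_linear_form_le) auto
  qed (rule zero_le_power[OF less_imp_le[OF eZ]])
  also have "\<dots> = (real n)\<^sup>2 * (?Z ^ (2 * m) / (exp 2 * ?Z) ^ (2 * m))"
    by (simp only: sum_constant card_lessThan power2_eq_square mult.assoc times_divide_eq_right)
  also have "?Z ^ (2 * m) / (exp 2 * ?Z) ^ (2 * m) = exp (- 4 * real m)"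
    by (rule power_div_exp_mult_power[OF Z])
  finally show ?thesis .
qed

section \<open>The multi-layer stochastic block model\<close>

locale msbm =
  fixes K :: nat and C0 :: real and n L :: nat and g :: "nat \<Rightarrow> nat"
    and B0 :: "nat \<Rightarrow> nat \<Rightarrow> nat \<Rightarrow> real" and \<rho> p :: real
  assumes valid: "msbm_valid K C0 n L g B0 \<rho> p"
begin

lemma params: "1 \<le> n" "1 \<le> L" "0 < p" "p \<le> 1" "0 < \<rho>" "\<And>i. i < n \<Longrightarrow> g i < K"
  using valid by (auto simp: msbm_valid_def)

text \<open>The lower bound 1 permits estimates such as \<open>C \<le> C * C\<close> and keeps the
  final constants positive for every \<open>C0\<close>.\<close>

definition C :: real where "C = max 1 C0"

lemma C_ge: "1 \<le> C" "C0 \<le> C"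
  by (simp_all add: C_def)

definition P :: "nat \<Rightarrow> nat \<Rightarrow> nat \<Rightarrow> real" where
  "P l = Pmat K g (\<lambda>k k'. \<rho> * B0 l k k')"

definition P0 :: "nat \<Rightarrow> nat \<Rightarrow> nat \<Rightarrow> real" where
  "P0 l i j = (if i = j then 0 else P l i j)"

text \<open>The centred indicator of an edge that is both present and sampled. Without the factor
  \<open>1 / p\<close> the entries are bounded by 1, so all higher moments are controlled by the
  variance.\<close>

definition noise :: "outcome \<Rightarrow> nat \<times> nat \<times> nat \<Rightarrow> real" where
  "noise \<omega> = (\<lambda>(l, i, j). of_bool (fst (\<omega> (l, i, j)) \<and> snd (\<omega> (l, i, j))) - p * (\<rho> * B0 l (g i) (g j)))"

text \<open>The entries of the sum over the layers of \<open>P0\<close> times noise; the product in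
  the other order is the transpose.\<close>

definition cross :: "outcome \<Rightarrow> nat \<Rightarrow> nat \<Rightarrow> real" where
  "cross \<omega> i j = (\<Sum>l<L. \<Sum>k<n. P0 l i k * sym_mat (noise \<omega>) l k j)"

lemma P_eq: "i < n \<Longrightarrow> j < n \<Longrightarrow> P l i j = \<rho> * B0 l (g i) (g j)"
proof -
  assume "i < n" "j < n"
  then have g: "g i < K" "g j < K" using params by auto
  have "P l i j = (\<Sum>k<K. if g i = k then \<Sum>k'<K. if g j = k' then \<rho> * B0 l k k' else 0 else 0)"
    unfolding P_def Pmat_def Theta_def
    by (rule sum.cong[OF refl]) (auto intro!: sum.cong[OF refl] simp del: sum.delta sum.delta')
  also have "\<dots> = \<rho> * B0 l (g i) (g j)" using g by simp
  finally show ?thesis .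
qed

lemma P_bounds:
  assumes "l < L" "i < n" "j < n"
  shows "0 \<le> P l i j" "P l i j \<le> C * \<rho>" "P l i j \<le> 1" "P l i j = P l j i"
proof -
  have B: "B0 l (g i) (g j) = B0 l (g j) (g i)" "0 \<le> B0 l (g i) (g j)" "B0 l (g i) (g j) \<le> C0"
    "\<rho> * B0 l (g i) (g j) \<le> 1"
    using valid assms params(6) unfolding msbm_valid_def by blast+
  then have "B0 l (g i) (g j) \<le> C" using C_ge by linarith
  then show "P l i j \<le> C * \<rho>" using assms params(5) by (simp add: P_eq mult.commute)
  show "0 \<le> P l i j" "P l i j \<le> 1" "P l i j = P l j i"
    using B assms params(5) by (simp_all add: P_eq)
qed

text \<open>The variances are at most \<open>C * p * \<rho>\<close>. The parameter \<alpha> stays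
  free because the quadratic and the linear part call for different values.\<close>

lemma repeated_moments_noise:
  assumes "1 \<le> \<alpha>"
  shows "repeated_moments (msbm_pmf n L g B0 \<rho> p) noise n L \<alpha> (C * p * \<rho> / \<alpha>)"
proof
  let ?D = "\<lambda>(l, i, j). pair_pmf (bernoulli_pmf (\<rho> * B0 l (g i) (g j))) (bernoulli_pmf p)"
  let ?f = "\<lambda>(l, i, j) y. of_bool (fst y \<and> snd y) - p * (\<rho> * B0 l (g i) (g j))"
  show "finite (set_pmf (msbm_pmf n L g B0 \<rho> p))"
    unfolding msbm_pmf_def
    by (rule finite_subset[OF set_Pi_pmf_subset'[OF finite_pair_index]])
       (intro finite_PiE_dflt finite_pair_index, auto)
  show "0 \<le> C * p * \<rho> / \<alpha>" using assms C_ge params by simp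
  show "0 \<le> \<alpha>" using assms by simp
  show "1 \<le> n" by (rule params)
  fix es r assume es: "set es \<subseteq> pair_index n L" "length es = 2 * r"
  have q: "0 \<le> \<rho> * B0 l (g i) (g j)" "\<rho> * B0 l (g i) (g j) \<le> 1" "\<rho> * B0 l (g i) (g j) \<le> C * \<rho>"
    if "(l, i, j) \<in> pair_index n L" for l i j
    using that P_bounds[of l i j] P_eq[of i j l] by (auto simp: pair_index_def)
  have noise: "noise \<omega> e = ?f e (\<omega> e)" for \<omega> e
    by (simp add: noise_def split: prod.split)
  have "\<bar>measure_pmf.expectation (Pi_pmf (pair_index n L) (False, False) ?D)
      (\<lambda>\<omega>. prod_list (map (\<lambda>e. ?f e (\<omega> e)) es))\<bar> \<le> \<alpha> ^ r * (C * p * \<rho> / \<alpha>) ^ card (set es)"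
  proof (rule repeated_word_moment_le[OF finite_pair_index])
    fix e assume e: "e \<in> pair_index n L"
    obtain l i j where lij: "e = (l, i, j)" by (cases e)
    note q' = q[OF e[unfolded lij]]
    show "measure_pmf.expectation (?D e) (?f e) = 0"
      using bernoulli_centred_moment[OF q'(1,2), of p 1] params by (simp add: lij algebra_simps)
    fix c :: nat assume c: "2 \<le> c"
    have "\<bar>measure_pmf.expectation (?D e) (\<lambda>y. ?f e y ^ c)\<bar> \<le> p * (\<rho> * B0 l (g i) (g j))"
      using bernoulli_centred_moment_le[OF q'(1,2), of p c] params c by (simp add: lij)
    also have "\<dots> \<le> p * (C * \<rho>)" using q'(3) params by (intro mult_left_mono) auto
    finally show "\<bar>measure_pmf.expectation (?D e) (\<lambda>y. ?f e y ^ c)\<bar> \<le> C * p * \<rho>" by (simp add: mult_ac)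
  qed (use es assms C_ge params in auto)
  then show "\<bar>measure_pmf.expectation (msbm_pmf n L g B0 \<rho> p) (\<lambda>\<omega>. prod_list (map (noise \<omega>) es))\<bar>
      \<le> \<alpha> ^ r * (C * p * \<rho> / \<alpha>) ^ card (set es)"
    unfolding msbm_pmf_def by (simp only: noise[abs_def])
qed

section \<open>Decomposition of the error matrix\<close>

lemma tildeA_eq:
  assumes "l < L" "i < n" "j < n"
  shows "tildeA p \<omega> l i j = sym_mat (noise \<omega>) l i j / p + P0 l i j"
proof -
  have "tildeA_upper p \<omega> l i j = noise \<omega> (l, i, j) / p + P l i j" if "i < n" "j < n" for i j
    using that params(3) by (auto simp: tildeA_upper_def noise_def P_eq field_simps)
  then show ?thesis
    using assms P_bounds(4)[OF assms]
    by (cases i j rule: linorder_cases) (auto simp: tildeA_def sym_mat_def edge_def P0_def)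
qed

text \<open>Entries of \<open>tildeA\<close> are 0 or \<open>1 / p\<close>, so a diagonal entry of
  its square is the degree over the square of \<open>p\<close>, exactly what the correction
  subtracts.\<close>

lemma Mbar_diagonal: "Mbar n L p \<omega> i i = 0"
proof -
  have "mmul n (tildeA p \<omega> l) (tildeA p \<omega> l) i i = real (tilde_deg n p \<omega> l i) / p\<^sup>2" for l
  proof -
    have "mmul n (tildeA p \<omega> l) (tildeA p \<omega> l) i i
        = (\<Sum>j<n. if tildeA p \<omega> l i j = 1 / p then 1 / p\<^sup>2 else 0)"
      unfolding mmul_def using params(3)
      by (intro sum.cong refl) (auto simp: tildeA_def tildeA_upper_def power2_eq_square)
    also have "\<dots> = real (card ({..<n} \<inter> {j. tildeA p \<omega> l i j = 1 / p})) / p\<^sup>2"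
      by (simp add: sum.If_cases)
    also have "{..<n} \<inter> {j. tildeA p \<omega> l i j = 1 / p} = {j. j < n \<and> tildeA p \<omega> l i j = 1 / p}"
      by auto
    finally show ?thesis by (simp add: tilde_deg_def)
  qed
  then show ?thesis by (simp add: Mbar_def field_simps)
qed

lemma PiMat_eq: "PiMat n L K g B0 \<rho> i j = (\<Sum>l<L. mmul n (P l) (P l) i j) / (real n * real L)"
  by (simp add: PiMat_def P_def sum_divide_distrib[symmetric])

text \<open>Off the diagonal, replacing \<open>P\<close> by \<open>P0\<close> drops just the two
  terms \<open>k = i\<close> and \<open>k = j\<close>.\<close>

lemma mmul_P0:
  assumes "i < n" "j < n" "i \<noteq> j"
  shows "mmul n (P0 l) (P0 l) i j = mmul n (P l) (P l) i j - (P l i i + P l j j) * P l i j"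
proof -
  have "mmul n (P0 l) (P0 l) i j = (\<Sum>k<n. P l i k * P l k j
      - ((if k = i then P l i k * P l k j else 0) + (if k = j then P l i k * P l k j else 0)))"
    unfolding mmul_def P0_def using assms by (intro sum.cong refl) auto
  also have "\<dots> = mmul n (P l) (P l) i j - (P l i i + P l j j) * P l i j"
    using assms by (simp add: sum_subtractf sum.distrib mmul_def algebra_simps)
  finally show ?thesis .
qed

lemma mmul_tildeA:
  assumes "l < L" "i < n" "j < n"
  shows "mmul n (tildeA p \<omega> l) (tildeA p \<omega> l) i j
    = mmul n (sym_mat (noise \<omega>) l) (sym_mat (noise \<omega>) l) i j / p\<^sup>2
      + ((\<Sum>k<n. P0 l i k * sym_mat (noise \<omega>) l k j) + (\<Sum>k<n. P0 l j k * sym_mat (noise \<omega>) l k i)) / p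
      + mmul n (P0 l) (P0 l) i j"
proof -
  let ?H = "sym_mat (noise \<omega>) l"
  have "mmul n (tildeA p \<omega> l) (tildeA p \<omega> l) i j
      = (\<Sum>k<n. ?H i k * ?H k j / p\<^sup>2 + (P0 l i k * ?H k j / p + P0 l j k * ?H k i / p) + P0 l i k * P0 l k j)"
    unfolding mmul_def
  proof (intro sum.cong refl)
    fix k assume k: "k \<in> {..<n}"
    \<comment> \<open>Symmetry turns the entry \<open>(i, j)\<close> of noise times
      \<open>P0\<close> into the entry \<open>(j, i)\<close> of \<open>P0\<close> times noise, so
      both cross terms are values of one function.\<close>
    then have "P0 l k j = P0 l j k" using assms by (auto simp: P0_def P_bounds(4))
    moreover have "?H k i = ?H i k" by (rule sym_mat_commute)
    ultimately show "tildeA p \<omega> l i k * tildeA p \<omega> l k j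
        = ?H i k * ?H k j / p\<^sup>2 + (P0 l i k * ?H k j / p + P0 l j k * ?H k i / p) + P0 l i k * P0 l k j"
      using k assms by (simp add: tildeA_eq ring_distribs add_divide_distrib power2_eq_square mult_ac)
  qed
  then show ?thesis
    by (simp add: mmul_def sum.distrib sum_divide_distrib add_divide_distrib)
qed

lemma Mbar_offdiagonal:
  assumes ij: "i < n" "j < n" "i \<noteq> j"
  shows "Mbar n L p \<omega> i j - PiMat n L K g B0 \<rho> i j
    = offdiag_gram n L (noise \<omega>) i j / (p\<^sup>2 * real n * real L)
      + ((cross \<omega> i j + cross \<omega> j i) / p - (\<Sum>l<L. (P l i i + P l j j) * P l i j)) / (real n * real L)"
proof -
  have "Mbar n L p \<omega> i j = (\<Sum>l<L. mmul n (tildeA p \<omega> l) (tildeA p \<omega> l) i j) / (real n * real L)"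
    using ij by (simp add: Mbar_def sum_divide_distrib[symmetric])
  also have "(\<Sum>l<L. mmul n (tildeA p \<omega> l) (tildeA p \<omega> l) i j)
      = (\<Sum>l<L. mmul n (sym_mat (noise \<omega>) l) (sym_mat (noise \<omega>) l) i j / p\<^sup>2
      + ((\<Sum>k<n. P0 l i k * sym_mat (noise \<omega>) l k j) + (\<Sum>k<n. P0 l j k * sym_mat (noise \<omega>) l k i)) / p
      + (mmul n (P l) (P l) i j - (P l i i + P l j j) * P l i j))"
    using ij by (intro sum.cong refl) (simp add: mmul_tildeA mmul_P0)
  also have "\<dots> = offdiag_gram n L (noise \<omega>) i j / p\<^sup>2 + (cross \<omega> i j + cross \<omega> j i) / p
      + ((\<Sum>l<L. mmul n (P l) (P l) i j) - (\<Sum>l<L. (P l i i + P l j j) * P l i j))"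
    unfolding sum.distrib sum_subtractf sum_divide_distrib[symmetric]
    using ij by (simp add: offdiag_gram_def cross_def)
  finally show ?thesis
    unfolding PiMat_eq by (simp add: add_divide_distrib diff_divide_distrib mult.assoc)
qed

text \<open>The error is split into the scaled Gram part, an off-diagonal matrix bounded entry by
  entry, and the diagonal of \<open>PiMat\<close>. Of the constant 3, two units come from the terms
  dropped with the diagonal of \<open>P\<close> and one from the diagonal of
  \<open>PiMat\<close>.\<close>

lemma spec_norm_error_le:
  assumes gram: "\<And>x. (\<Sum>i<n. (x i)\<^sup>2) = 1 \<Longrightarrow>
      L2_set (\<lambda>i. \<Sum>j<n. offdiag_gram n L (noise \<omega>) i j * x j) {..<n} \<le> y"
    and cross: "\<And>i j. i < n \<Longrightarrow> j < n \<Longrightarrow> \<bar>cross \<omega> i j\<bar> \<le> \<gamma>"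
  shows "spec_norm n (\<lambda>i j. Mbar n L p \<omega> i j - PiMat n L K g B0 \<rho> i j)
    \<le> y / (p\<^sup>2 * real n * real L) + 2 * \<gamma> / (p * real L) + 3 * C\<^sup>2 * \<rho>\<^sup>2"
proof (rule spec_norm_le[OF params(1)])
  fix x :: "nat \<Rightarrow> real" assume x: "(\<Sum>i<n. (x i)\<^sup>2) = 1"
  define N where "N = real n * real L"
  have N: "0 < N" using params(1,2) by (simp add: N_def)
  \<comment> \<open>Collects the cross terms and the terms dropped by passing from \<open>P\<close>
    to \<open>P0\<close>; both are small enough for the Frobenius bound.\<close>
  define Q where "Q i j = (if i = j then 0 else
    ((cross \<omega> i j + cross \<omega> j i) / p - (\<Sum>l<L. (P l i i + P l j j) * P l i j)) / N)" for i j
  define d where "d i = - PiMat n L K g B0 \<rho> i i" for i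
  let ?Y = "offdiag_gram n L (noise \<omega>)"
  have PP: "\<bar>P l i j * P l i' j'\<bar> \<le> C\<^sup>2 * \<rho>\<^sup>2" if "l < L" "i < n" "j < n" "i' < n" "j' < n" for l i j i' j'
  proof -
    have "P l i j * P l i' j' \<le> (C * \<rho>) * (C * \<rho>)"
      using that P_bounds params C_ge by (intro mult_mono) auto
    then show ?thesis using that P_bounds(1) by (simp add: power2_eq_square mult_ac)
  qed
  have \<gamma>: "0 \<le> \<gamma>" using cross[of 0 0] params(1) by auto
  define q where "q = (2 * \<gamma> / p + real L * (2 * (C\<^sup>2 * \<rho>\<^sup>2))) / N"
  have q: "0 \<le> q" using \<gamma> params N by (simp add: q_def)
  have Q: "\<bar>Q i j\<bar> \<le> q" if ij: "i < n" "j < n" for i j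
  proof (cases "i = j")
    case False
    have "\<bar>\<Sum>l<L. (P l i i + P l j j) * P l i j\<bar> \<le> (\<Sum>l<L. \<bar>(P l i i + P l j j) * P l i j\<bar>)"
      by (rule sum_abs)
    also have "\<dots> \<le> (\<Sum>l<L. 2 * (C\<^sup>2 * \<rho>\<^sup>2))"
    proof (rule sum_mono)
      fix l assume "l \<in> {..<L}"
      then have "\<bar>P l i i * P l i j\<bar> \<le> C\<^sup>2 * \<rho>\<^sup>2" "\<bar>P l j j * P l i j\<bar> \<le> C\<^sup>2 * \<rho>\<^sup>2"
        using ij by (auto intro!: PP)
      then show "\<bar>(P l i i + P l j j) * P l i j\<bar> \<le> 2 * (C\<^sup>2 * \<rho>\<^sup>2)"
        unfolding distrib_right by linarith
    qed
    finally have 1: "\<bar>\<Sum>l<L. (P l i i + P l j j) * P l i j\<bar> \<le> real L * (2 * (C\<^sup>2 * \<rho>\<^sup>2))"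
      by simp
    have "\<bar>cross \<omega> i j + cross \<omega> j i\<bar> \<le> 2 * \<gamma>"
      using cross[OF ij] cross[OF ij(2,1)] by linarith
    then have "\<bar>(cross \<omega> i j + cross \<omega> j i) / p\<bar> \<le> 2 * \<gamma> / p"
      using params(3) by (simp add: divide_right_mono)
    with 1 have "\<bar>(cross \<omega> i j + cross \<omega> j i) / p - (\<Sum>l<L. (P l i i + P l j j) * P l i j)\<bar>
        \<le> 2 * \<gamma> / p + real L * (2 * (C\<^sup>2 * \<rho>\<^sup>2))" by linarith
    then show ?thesis using False N by (simp add: Q_def q_def divide_right_mono)
  qed (use q in \<open>simp add: Q_def\<close>)
  have d: "\<bar>d i\<bar> \<le> C\<^sup>2 * \<rho>\<^sup>2" if i: "i < n" for i
  proof -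
    have "\<bar>\<Sum>l<L. mmul n (P l) (P l) i i\<bar> \<le> (\<Sum>l<L. \<Sum>k<n. \<bar>P l i k * P l k i\<bar>)"
      unfolding mmul_def by ((rule order.trans[OF sum_abs], rule sum_mono)+, rule order.refl)
    also have "\<dots> \<le> (\<Sum>l<L. \<Sum>k<n. C\<^sup>2 * \<rho>\<^sup>2)"
      using i by (intro sum_mono PP) auto
    finally have "\<bar>\<Sum>l<L. mmul n (P l) (P l) i i\<bar> \<le> N * (C\<^sup>2 * \<rho>\<^sup>2)"
      by (simp add: N_def mult_ac)
    then have "\<bar>\<Sum>l<L. mmul n (P l) (P l) i i\<bar> / N \<le> C\<^sup>2 * \<rho>\<^sup>2"
      using N by (simp add: divide_le_eq mult.commute)
    then show ?thesis using N
      by (simp add: d_def PiMat_eq N_def[symmetric])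
  qed
  have decomp: "(\<Sum>j<n. (Mbar n L p \<omega> i j - PiMat n L K g B0 \<rho> i j) * x j)
      = (\<Sum>j<n. ?Y i j * x j) / (p\<^sup>2 * N) + ((\<Sum>j<n. Q i j * x j) + (\<Sum>j<n. (if i = j then d i else 0) * x j))"
    if "i < n" for i
    unfolding sum_divide_distrib sum.distrib[symmetric]
  proof (intro sum.cong refl)
    fix j assume "j \<in> {..<n}"
    then have "Mbar n L p \<omega> i j - PiMat n L K g B0 \<rho> i j = ?Y i j / (p\<^sup>2 * N) + (Q i j + (if i = j then d i else 0))"
      using that Mbar_offdiagonal[of i j \<omega>]
      by (cases "i = j") (simp_all add: Mbar_diagonal d_def Q_def offdiag_gram_def N_def mult.assoc)
    then show "(Mbar n L p \<omega> i j - PiMat n L K g B0 \<rho> i j) * x j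
        = ?Y i j * x j / (p\<^sup>2 * N) + (Q i j * x j + (if i = j then d i else 0) * x j)"
      by (simp only: distrib_right times_divide_eq_left)
  qed
  have "L2_set (\<lambda>i. \<Sum>j<n. (Mbar n L p \<omega> i j - PiMat n L K g B0 \<rho> i j) * x j) {..<n}
      = L2_set (\<lambda>i. (\<Sum>j<n. ?Y i j * x j) / (p\<^sup>2 * N) + ((\<Sum>j<n. Q i j * x j) + (\<Sum>j<n. (if i = j then d i else 0) * x j))) {..<n}"
    using decomp by (intro L2_set_cong) auto
  also have "\<dots> \<le> L2_set (\<lambda>i. (\<Sum>j<n. ?Y i j * x j) / (p\<^sup>2 * N)) {..<n}
      + (L2_set (\<lambda>i. \<Sum>j<n. Q i j * x j) {..<n} + L2_set (\<lambda>i. \<Sum>j<n. (if i = j then d i else 0) * x j) {..<n})"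
    by (intro order.trans[OF L2_set_triangle_ineq] add_left_mono L2_set_triangle_ineq)
  also have "\<dots> \<le> y / (p\<^sup>2 * N) + (real n * q + C\<^sup>2 * \<rho>\<^sup>2)"
  proof (intro add_mono)
    have "L2_set (\<lambda>i. (\<Sum>j<n. ?Y i j * x j) / (p\<^sup>2 * N)) {..<n}
        = L2_set (\<lambda>i. \<Sum>j<n. ?Y i j * x j) {..<n} / (p\<^sup>2 * N)"
      using N L2_set_left_distrib[of "1 / (p\<^sup>2 * N)" "\<lambda>i. \<Sum>j<n. ?Y i j * x j" "{..<n}"] by simp
    also have "\<dots> \<le> y / (p\<^sup>2 * N)" using gram[OF x] N by (intro divide_right_mono) auto
    finally show "L2_set (\<lambda>i. (\<Sum>j<n. ?Y i j * x j) / (p\<^sup>2 * N)) {..<n} \<le> y / (p\<^sup>2 * N)" .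
    show "L2_set (\<lambda>i. \<Sum>j<n. Q i j * x j) {..<n} \<le> real n * q"
      by (rule entrywise_bound_L2_set[OF Q q x])
    show "L2_set (\<lambda>i. \<Sum>j<n. (if i = j then d i else 0) * x j) {..<n} \<le> C\<^sup>2 * \<rho>\<^sup>2"
      by (rule diagonal_bound_L2_set[OF d x]) auto
  qed
  also have "real n * q = 2 * \<gamma> / (p * real L) + 2 * (C\<^sup>2 * \<rho>\<^sup>2)"
    using params(1,2,3) by (simp add: q_def N_def field_simps)
  finally show "L2_set (\<lambda>i. \<Sum>j<n. (Mbar n L p \<omega> i j - PiMat n L K g B0 \<rho> i j) * x j) {..<n}
      \<le> y / (p\<^sup>2 * real n * real L) + 2 * \<gamma> / (p * real L) + 3 * C\<^sup>2 * \<rho>\<^sup>2"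
    by (simp add: N_def mult_ac)
qed

end

section \<open>Choice of the weights and the two sparsity regimes\<close>

context msbm
begin

text \<open>The hypothesis \<open>big\<close> says precisely that the balancing weight \<alpha> is
  at least 1. The factor \<open>c\<close> leaves room for an arbitrary constant in the lower bound
  on \<rho>.\<close>

lemma prob_spec_norm_error:
  assumes m: "1 \<le> m" and c: "1 \<le> c" and big: "real m \<le> c * (real n * (C * p * \<rho>) * sqrt (real L))"
  shows "1 - 2 * (real n)\<^sup>2 * exp (- 4 * real m) \<le> measure_pmf.prob (msbm_pmf n L g B0 \<rho> p)
    {\<omega>. spec_norm n (\<lambda>i j. Mbar n L p \<omega> i j - PiMat n L K g B0 \<rho> i j)
      \<le> exp 2 * 29 * c * C\<^sup>2 * (real m * \<rho> / (p * sqrt (real L))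
          + \<rho> * sqrt (real m * real n * p * \<rho>) / (p * sqrt (real L)) + \<rho>\<^sup>2)}"
proof -
  let ?M = "msbm_pmf n L g B0 \<rho> p"
  define v where "v = C * p * \<rho>"
  define s where "s = sqrt (real L)"
  have s: "1 \<le> s" "s\<^sup>2 = real L" using params(2) by (auto simp: s_def)
  have v: "0 < v" using params C_ge by (simp add: v_def)
  have n0: "0 < real n" "1 \<le> real n" and m0: "0 < real m" and c0: "0 < c"
    using params m c by auto
  \<comment> \<open>Up to constants, \<alpha> balances the terms of \<open>walk_rate\<close> with
    both edges new and with both edges old. Similarly \<beta>, larger by a factor \<open>s\<close>,
    balances \<open>n * L * v / \<beta>\<close> with \<open>2 * m\<close> in the linear
    bound.\<close>
  define \<alpha> \<beta> where "\<alpha> = c * (real n * v * s) / real m" and "\<beta> = c * (real n * v * s\<^sup>2) / real m"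
  have \<alpha>: "1 \<le> \<alpha>" using big m0 by (simp add: \<alpha>_def v_def s_def)
  have "\<alpha> * 1 \<le> \<alpha> * s" using \<alpha> s by (intro mult_left_mono) auto
  also have "\<alpha> * s = \<beta>" by (simp add: \<alpha>_def \<beta>_def power2_eq_square)
  finally have \<beta>: "1 \<le> \<beta>" using \<alpha> by simp
  interpret A: repeated_moments ?M noise n L \<alpha> "v / \<alpha>"
    using repeated_moments_noise[OF \<alpha>] by (simp add: v_def)
  interpret B: repeated_moments ?M noise n L \<beta> "v / \<beta>"
    using repeated_moments_noise[OF \<beta>] by (simp add: v_def)
  define Y where "Y = \<alpha> * walk_rate n L (v / \<alpha>) (4 * m)"
  define Z where "Z = sqrt \<beta> * (C * \<rho> * (real n * real L * (v / \<beta>) + 2 * real m))"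
  define bad1 where "bad1 = {\<omega>. \<exists>x. (\<Sum>i<n. (x i)\<^sup>2) = 1 \<and>
      exp 2 * Y < L2_set (\<lambda>i. \<Sum>j<n. offdiag_gram n L (noise \<omega>) i j * x j) {..<n}}"
  define bad2 where "bad2 = {\<omega>. \<exists>i<n. \<exists>j<n. exp 2 * Z < \<bar>cross \<omega> i j\<bar>}"
  have bad1: "measure_pmf.prob ?M bad1 \<le> real n * exp (- 4 * real m)"
    unfolding bad1_def Y_def by (rule A.prob_gram_large_le[OF m \<alpha>])
  have bad2: "measure_pmf.prob ?M bad2 \<le> (real n)\<^sup>2 * exp (- 4 * real m)"
    unfolding bad2_def Z_def cross_def
  proof (rule B.prob_linear_large_le[OF m \<beta>])
    show "0 < C * \<rho>" using C_ge params by simp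
    show "\<bar>P0 l i k\<bar> \<le> C * \<rho>" if "i < n" "l < L" "k < n" for i l k
      using that P_bounds[of l i k] C_ge params by (auto simp: P0_def)
  qed
  \<comment> \<open>The constant is 29 = 1 + 12 + 16, one summand for each term of
    \<open>walk_rate\<close> at \<open>4 * m\<close>.\<close>
  have Y: "Y \<le> 29 * c * (real m * real n * v * s)"
  proof -
    have "Y = (real n)\<^sup>2 * s\<^sup>2 * v\<^sup>2 / \<alpha> + 12 * real m * real n * v + 16 * (real m)\<^sup>2 * \<alpha>"
      using \<alpha> by (simp add: Y_def walk_rate_def s(2)[symmetric] field_simps power2_eq_square)
    also have "(real n)\<^sup>2 * s\<^sup>2 * v\<^sup>2 / \<alpha> = real m * real n * v * s / c"
      using n0 m0 c0 v s(1) by (simp add: \<alpha>_def power2_eq_square)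
    also have "16 * (real m)\<^sup>2 * \<alpha> = 16 * c * (real m * real n * v * s)"
      using m0 by (simp add: \<alpha>_def power2_eq_square)
    also have "real m * real n * v * s / c \<le> c * (real m * real n * v * s)"
    proof -
      have "real m * real n * v * s / c \<le> real m * real n * v * s / 1"
        using c v s by (intro divide_left_mono) auto
      also have "\<dots> \<le> c * (real m * real n * v * s)"
        using c v s mult_right_mono[of 1 c "real m * real n * v * s"] by simp
      finally show ?thesis .
    qed
    also have "12 * real m * real n * v \<le> 12 * c * (real m * real n * v * s)"
    proof -
      have "1 * 1 \<le> c * s" using c s by (intro mult_mono) auto
      then have "(12 * real m * real n * v) * 1 \<le> (12 * real m * real n * v) * (c * s)"
        using v by (intro mult_left_mono) auto
      then show ?thesis by (simp add: mult_ac)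
    qed
    finally show ?thesis by (simp add: mult_ac)
  qed
  \<comment> \<open>With this \<beta> the new edges contribute \<open>m / c \<le> m\<close> and the
    old ones \<open>2 * m\<close>, which gives the factor 3.\<close>
  have Z: "Z \<le> 3 * c * C\<^sup>2 * (\<rho> * s * sqrt (real m * real n * p * \<rho>))"
  proof -
    have "real n * real L * (v / \<beta>) = real m / c"
      using n0 m0 c0 v s by (simp add: \<beta>_def s(2)[symmetric])
    also have "\<dots> \<le> real m" using c m0 by (simp add: divide_le_eq mult_le_cancel_left1)
    finally have "Z \<le> sqrt \<beta> * (C * \<rho> * (real m + 2 * real m))"
      unfolding Z_def using \<beta> C_ge params by (intro mult_left_mono add_right_mono) auto
    also have "\<dots> = 3 * C * \<rho> * (real m * sqrt \<beta>)" by simp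
    also have "real m * sqrt \<beta> = sqrt ((real m)\<^sup>2 * \<beta>)" by (simp add: real_sqrt_mult)
    also have "(real m)\<^sup>2 * \<beta> = (c * C) * (s\<^sup>2 * (real m * real n * p * \<rho>))"
      using m0 by (simp add: \<beta>_def v_def power2_eq_square)
    also have "sqrt \<dots> = sqrt (c * C) * (s * sqrt (real m * real n * p * \<rho>))"
      using s(1) by (simp add: real_sqrt_mult)
    also have "3 * C * \<rho> * (sqrt (c * C) * (s * sqrt (real m * real n * p * \<rho>)))
        \<le> 3 * C * \<rho> * ((c * C) * (s * sqrt (real m * real n * p * \<rho>)))"
    proof (intro mult_left_mono mult_right_mono)
      have "1 * 1 \<le> c * C" using c C_ge by (intro mult_mono) auto
      then show "sqrt (c * C) \<le> c * C"
        using mult_left_mono[of 1 "c * C" "c * C"] by (intro real_le_lsqrt) (simp_all add: power2_eq_square)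
    qed (use C_ge params s in auto)
    finally show ?thesis by (simp add: power2_eq_square mult_ac)
  qed
  have good: "spec_norm n (\<lambda>i j. Mbar n L p \<omega> i j - PiMat n L K g B0 \<rho> i j)
      \<le> exp 2 * 29 * c * C\<^sup>2 * (real m * \<rho> / (p * s) + \<rho> * sqrt (real m * real n * p * \<rho>) / (p * s) + \<rho>\<^sup>2)"
    if "\<omega> \<notin> bad1" "\<omega> \<notin> bad2" for \<omega>
  proof -
    have "spec_norm n (\<lambda>i j. Mbar n L p \<omega> i j - PiMat n L K g B0 \<rho> i j)
        \<le> (exp 2 * Y) / (p\<^sup>2 * real n * real L) + 2 * (exp 2 * Z) / (p * real L) + 3 * C\<^sup>2 * \<rho>\<^sup>2"
    proof (rule spec_norm_error_le)
      show "\<bar>cross \<omega> i j\<bar> \<le> exp 2 * Z" if "i < n" "j < n" for i j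
        using \<open>\<omega> \<notin> bad2\<close> that unfolding bad2_def mem_Collect_eq by (meson not_less)
    qed (use that(1) in \<open>auto simp: bad1_def not_less\<close>)
    also have "\<dots> \<le> exp 2 * 29 * c * C\<^sup>2 * (real m * \<rho> / (p * s))
        + exp 2 * 29 * c * C\<^sup>2 * (\<rho> * sqrt (real m * real n * p * \<rho>) / (p * s)) + exp 2 * 29 * c * C\<^sup>2 * \<rho>\<^sup>2"
    proof (intro add_mono)
      have CC: "C \<le> C\<^sup>2" using C_ge by (simp add: power2_eq_square mult_le_cancel_left1)
      have "(exp 2 * Y) / (p\<^sup>2 * real n * real L)
          \<le> (exp 2 * (29 * c * (real m * real n * v * s))) / (p\<^sup>2 * real n * real L)"
        using Y by (intro divide_right_mono mult_left_mono) auto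
      also have "\<dots> = exp 2 * 29 * c * C * (real m * \<rho> / (p * s))"
        using params(3) n0 s by (simp add: v_def s(2)[symmetric] power2_eq_square)
      also have "\<dots> \<le> exp 2 * 29 * c * C\<^sup>2 * (real m * \<rho> / (p * s))"
        using c0 s params CC by (intro mult_right_mono mult_left_mono) auto
      finally show "(exp 2 * Y) / (p\<^sup>2 * real n * real L) \<le> \<dots>" .
      have "2 * (exp 2 * Z) / (p * real L)
          \<le> 2 * (exp 2 * (3 * c * C\<^sup>2 * (\<rho> * s * sqrt (real m * real n * p * \<rho>)))) / (p * real L)"
        using Z params(3) by (intro divide_right_mono mult_left_mono) auto
      also have "\<dots> = 6 * (exp 2 * c * C\<^sup>2 * (\<rho> * sqrt (real m * real n * p * \<rho>) / (p * s)))"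
        using s by (simp add: s(2)[symmetric] power2_eq_square)
      also have "\<dots> \<le> 29 * (exp 2 * c * C\<^sup>2 * (\<rho> * sqrt (real m * real n * p * \<rho>) / (p * s)))"
        using s params c0 by (intro mult_right_mono) auto
      finally show "2 * (exp 2 * Z) / (p * real L)
          \<le> exp 2 * 29 * c * C\<^sup>2 * (\<rho> * sqrt (real m * real n * p * \<rho>) / (p * s))" by (simp add: mult_ac)
      have "1 * 1 \<le> exp 2 * c" using c by (intro mult_mono) auto
      then have "3 \<le> exp 2 * 29 * c" by simp
      then have "3 * (C\<^sup>2 * \<rho>\<^sup>2) \<le> (exp 2 * 29 * c) * (C\<^sup>2 * \<rho>\<^sup>2)" by (intro mult_right_mono) auto
      then show "3 * C\<^sup>2 * \<rho>\<^sup>2 \<le> exp 2 * 29 * c * C\<^sup>2 * \<rho>\<^sup>2" by (simp only: mult.assoc)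
    qed
    finally show ?thesis by (simp only: distrib_left)
  qed
  let ?G = "{\<omega>. spec_norm n (\<lambda>i j. Mbar n L p \<omega> i j - PiMat n L K g B0 \<rho> i j)
      \<le> exp 2 * 29 * c * C\<^sup>2 * (real m * \<rho> / (p * s) + \<rho> * sqrt (real m * real n * p * \<rho>) / (p * s) + \<rho>\<^sup>2)}"
  have "measure_pmf.prob ?M (bad1 \<union> bad2) \<le> measure_pmf.prob ?M bad1 + measure_pmf.prob ?M bad2"
    by (rule measure_subadditive) auto
  also have "\<dots> \<le> real n * exp (- 4 * real m) + (real n)\<^sup>2 * exp (- 4 * real m)"
    by (rule add_mono[OF bad1 bad2])
  also have "real n * exp (- 4 * real m) \<le> (real n)\<^sup>2 * exp (- 4 * real m)"
    using n0 by (intro mult_right_mono) (auto simp: power2_eq_square)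
  finally have "measure_pmf.prob ?M (bad1 \<union> bad2) \<le> 2 * (real n)\<^sup>2 * exp (- 4 * real m)" by simp
  moreover have "1 - measure_pmf.prob ?M (bad1 \<union> bad2) = measure_pmf.prob ?M (- (bad1 \<union> bad2))"
    using measure_pmf.prob_compl[of "bad1 \<union> bad2" ?M] by (simp add: Compl_eq_Diff_UNIV)
  moreover have "measure_pmf.prob ?M (- (bad1 \<union> bad2)) \<le> measure_pmf.prob ?M ?G"
    using good by (intro measure_pmf.finite_measure_mono) auto
  ultimately have "1 - 2 * (real n)\<^sup>2 * exp (- 4 * real m) \<le> measure_pmf.prob ?M ?G" by linarith
  then show ?thesis by (simp only: s_def)
qed

text \<open>There are at least one layer and one node, so the logarithm is at least
  \<open>ln 2\<close>. A bound away from 0 allows rounding the logarithm up and comparing it with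
  its square, at the cost of a constant.\<close>

lemma ln_size_ge: "1 / 2 \<le> ln (real L + real n)"
proof -
  have "(1::real) / 2 \<le> ln 2" by (rule order.trans[OF _ ln2_ge_two_thirds]) simp
  also have "ln 2 \<le> ln (real L + real n)" using params(1,2) by simp
  finally show ?thesis .
qed

lemma prob_spec_norm_error_ln:
  assumes a: "0 < a" and big: "a * ln (real L + real n) \<le> real n * p * \<rho> * sqrt (real L)"
  shows "1 - 2 * (real L + real n) powr - 2 \<le> measure_pmf.prob (msbm_pmf n L g B0 \<rho> p)
    {\<omega>. spec_norm n (\<lambda>i j. Mbar n L p \<omega> i j - PiMat n L K g B0 \<rho> i j)
      \<le> exp 2 * 87 * (1 + 3 / a) * C\<^sup>2 * (\<rho> * ln (real L + real n) / (p * sqrt (real L))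
          + \<rho> * sqrt (ln (real L + real n) * real n * p * \<rho>) / (p * sqrt (real L)) + \<rho>\<^sup>2)}"
proof -
  define \<eta> where "\<eta> = ln (real L + real n)"
  define m where "m = nat \<lceil>\<eta>\<rceil>"
  \<comment> \<open>The 3 pays for rounding, since \<open>m \<le> 3 * \<eta>\<close>, and
    \<open>1 / a\<close> comes from the hypothesis \<open>big\<close>; the summand 1 ensures
    \<open>1 \<le> c\<close>.\<close>
  define c where "c = 1 + 3 / a"
  have \<eta>: "1 / 2 \<le> \<eta>" unfolding \<eta>_def by (rule ln_size_ge)
  have m1: "1 \<le> m" using \<eta> unfolding m_def by linarith
  have lm: "\<eta> \<le> real m" "real m \<le> 3 * \<eta>" using \<eta> unfolding m_def by linarith+
  have c: "1 \<le> c" "3 / a \<le> c" using a by (auto simp: c_def)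
  have npos: "0 \<le> real n * p * \<rho> * sqrt (real L)" using params by simp
  have "real m \<le> (3 / a) * (a * \<eta>)" using lm a by simp
  also have "\<dots> \<le> c * (real n * p * \<rho> * sqrt (real L))"
    by (rule mult_mono) (use c a big \<eta> in \<open>auto simp: \<eta>_def\<close>)
  also have "\<dots> \<le> c * (C * (real n * p * \<rho> * sqrt (real L)))"
    using c C_ge mult_right_mono[OF C_ge(1) npos] by (intro mult_left_mono) auto
  finally have big': "real m \<le> c * (real n * (C * p * \<rho>) * sqrt (real L))" by (simp add: mult_ac)
  let ?U = "real m * \<rho> / (p * sqrt (real L)) + \<rho> * sqrt (real m * real n * p * \<rho>) / (p * sqrt (real L)) + \<rho>\<^sup>2"
  let ?V = "\<rho> * \<eta> / (p * sqrt (real L)) + \<rho> * sqrt (\<eta> * real n * p * \<rho>) / (p * sqrt (real L)) + \<rho>\<^sup>2"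
  \<comment> \<open>Replacing \<open>m\<close> by \<eta> costs a factor of at most 3, which turns 29
    into 87.\<close>
  have UV: "?U \<le> 3 * ?V"
  proof -
    have "real m * \<rho> / (p * sqrt (real L)) \<le> (3 * \<eta>) * \<rho> / (p * sqrt (real L))"
      using lm params by (intro divide_right_mono mult_right_mono) auto
    also have "\<dots> = 3 * (\<rho> * \<eta> / (p * sqrt (real L)))" by simp
    finally have 1: "real m * \<rho> / (p * sqrt (real L)) \<le> \<dots>" .
    have "\<rho> * sqrt (real m * real n * p * \<rho>) / (p * sqrt (real L))
        \<le> \<rho> * (3 * sqrt (\<eta> * real n * p * \<rho>)) / (p * sqrt (real L))"
    proof (intro divide_right_mono mult_left_mono)
      have "sqrt (real m * real n * p * \<rho>) \<le> sqrt (9 * (\<eta> * real n * p * \<rho>))"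
        using lm \<eta> params mult_right_mono[of "real m" "9 * \<eta>" "real n * p * \<rho>"]
        by (intro real_sqrt_le_mono) (simp add: mult_ac)
      then show "sqrt (real m * real n * p * \<rho>) \<le> 3 * sqrt (\<eta> * real n * p * \<rho>)"
        by (simp add: real_sqrt_mult)
    qed (use params in auto)
    also have "\<dots> = 3 * (\<rho> * sqrt (\<eta> * real n * p * \<rho>) / (p * sqrt (real L)))" by simp
    finally have 2: "\<rho> * sqrt (real m * real n * p * \<rho>) / (p * sqrt (real L)) \<le> \<dots>" .
    have "\<rho>\<^sup>2 \<le> 3 * \<rho>\<^sup>2" by simp
    with 1 2 show ?thesis unfolding distrib_left by (intro add_mono)
  qed
  have "(exp 2 * 29 * c * C\<^sup>2) * ?U \<le> (exp 2 * 29 * c * C\<^sup>2) * (3 * ?V)"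
    using c by (intro mult_left_mono[OF UV]) auto
  also have "\<dots> = exp 2 * 87 * c * C\<^sup>2 * ?V" by simp
  finally have le: "exp 2 * 29 * c * C\<^sup>2 * ?U \<le> exp 2 * 87 * c * C\<^sup>2 * ?V" .
  \<comment> \<open>The decay \<open>exp (- 4 * \<eta>)\<close> is \<open>L + n\<close> to the power
    -4; the number of pairs costs at most the power 2, leaving -2.\<close>
  have "2 * (real n)\<^sup>2 * exp (- 4 * real m) \<le> 2 * ((real L + real n)\<^sup>2 * exp (- 4 * \<eta>))"
  proof -
    have "(real n)\<^sup>2 * exp (- 4 * real m) \<le> (real L + real n)\<^sup>2 * exp (- 4 * \<eta>)"
      using lm by (intro mult_mono power_mono) auto
    then show ?thesis by simp
  qed
  also have "(real L + real n)\<^sup>2 * exp (- 4 * \<eta>) = (real L + real n) powr - 2"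
  proof -
    have pos: "0 < real L + real n" using params by simp
    then have "exp (- 4 * \<eta>) = (real L + real n) powr - 4" by (simp add: powr_def \<eta>_def)
    moreover have "(real L + real n)\<^sup>2 = (real L + real n) powr 2" using pos by (simp add: powr_numeral)
    ultimately show ?thesis by (simp only: powr_add[symmetric]) simp
  qed
  finally have "1 - 2 * (real L + real n) powr - 2 \<le> 1 - 2 * (real n)\<^sup>2 * exp (- 4 * real m)" by simp
  also have "\<dots> \<le> measure_pmf.prob (msbm_pmf n L g B0 \<rho> p)
      {\<omega>. spec_norm n (\<lambda>i j. Mbar n L p \<omega> i j - PiMat n L K g B0 \<rho> i j) \<le> exp 2 * 29 * c * C\<^sup>2 * ?U}"
    by (rule prob_spec_norm_error[OF m1 c(1) big'])
  also have "\<dots> \<le> measure_pmf.prob (msbm_pmf n L g B0 \<rho> p)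
      {\<omega>. spec_norm n (\<lambda>i j. Mbar n L p \<omega> i j - PiMat n L K g B0 \<rho> i j) \<le> exp 2 * 87 * c * C\<^sup>2 * ?V}"
    using le by (intro measure_pmf.finite_measure_mono) (auto intro: order.trans)
  finally show ?thesis by (simp only: \<eta>_def c_def)
qed

text \<open>Reduces each regime to comparing the two random rates with a target \<open>t\<close>;
  the remaining \<rho>-squared is absorbed by the maximum, which adds 1 to \<open>D\<close>.\<close>

lemma prob_spec_norm_error_le:
  assumes a: "0 < a" and big: "a * ln (real L + real n) \<le> real n * p * \<rho> * sqrt (real L)"
    and D: "0 \<le> D" and t: "\<rho> * ln (real L + real n) / (p * sqrt (real L))
          + \<rho> * sqrt (ln (real L + real n) * real n * p * \<rho>) / (p * sqrt (real L)) \<le> D * t"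
  shows "1 - 2 * (real L + real n) powr - 2 \<le> measure_pmf.prob (msbm_pmf n L g B0 \<rho> p)
    {\<omega>. spec_norm n (\<lambda>i j. Mbar n L p \<omega> i j - PiMat n L K g B0 \<rho> i j)
      \<le> exp 2 * 87 * (1 + 3 / a) * C\<^sup>2 * (D + 1) * max t (\<rho>\<^sup>2)}"
proof (rule order.trans[OF prob_spec_norm_error_ln[OF a big]])
  let ?V = "\<rho> * ln (real L + real n) / (p * sqrt (real L))
          + \<rho> * sqrt (ln (real L + real n) * real n * p * \<rho>) / (p * sqrt (real L)) + \<rho>\<^sup>2"
  have "D * t \<le> D * max t (\<rho>\<^sup>2)" using D by (intro mult_left_mono) auto
  then have "?V \<le> (D + 1) * max t (\<rho>\<^sup>2)"
    using t unfolding distrib_right by linarith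
  then have "exp 2 * 87 * (1 + 3 / a) * C\<^sup>2 * ?V \<le> exp 2 * 87 * (1 + 3 / a) * C\<^sup>2 * ((D + 1) * max t (\<rho>\<^sup>2))"
    using a by (intro mult_left_mono) auto
  then show "measure_pmf.prob (msbm_pmf n L g B0 \<rho> p)
      {\<omega>. spec_norm n (\<lambda>i j. Mbar n L p \<omega> i j - PiMat n L K g B0 \<rho> i j) \<le> exp 2 * 87 * (1 + 3 / a) * C\<^sup>2 * ?V}
    \<le> measure_pmf.prob (msbm_pmf n L g B0 \<rho> p)
      {\<omega>. spec_norm n (\<lambda>i j. Mbar n L p \<omega> i j - PiMat n L K g B0 \<rho> i j)
        \<le> exp 2 * 87 * (1 + 3 / a) * C\<^sup>2 * (D + 1) * max t (\<rho>\<^sup>2)}"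
    by (intro measure_pmf.finite_measure_mono) (auto simp: mult.assoc intro: order.trans)
qed

text \<open>Since \<open>n * p * \<rho> \<le> b\<close> and \<open>1 \<le> 2 * \<eta>\<close>, the
  square root is at most a constant times \<eta>, so the Gram rate governs the sum. The stated rate
  is weaker still, as \<open>p powr (3/2) \<le> p\<close> for \<open>p \<le> 1\<close>.\<close>

lemma sparse_rate_le:
  assumes b: "0 < b" and up: "\<rho> \<le> b / (p * real n)"
  shows "\<rho> * ln (real L + real n) / (p * sqrt (real L))
      + \<rho> * sqrt (ln (real L + real n) * real n * p * \<rho>) / (p * sqrt (real L))
    \<le> (1 + sqrt (2 * b)) * (\<rho> * ln (real L + real n) / (p powr (3/2) * sqrt (real L)))"
proof -
  define \<eta> where "\<eta> = ln (real L + real n)"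
  have \<eta>: "1 / 2 \<le> \<eta>" unfolding \<eta>_def by (rule ln_size_ge)
  have n0: "0 < real n" "0 < sqrt (real L)" using params by auto
  have "real n * p * \<rho> \<le> b" using up params n0 by (simp add: field_simps)
  then have "\<eta> * (real n * p * \<rho>) \<le> \<eta> * b" using \<eta> by (intro mult_left_mono) auto
  also have "\<dots> \<le> \<eta> * b * (2 * \<eta>)" using \<eta> b mult_left_mono[of 1 "2 * \<eta>" "\<eta> * b"] by simp
  finally have "sqrt (\<eta> * real n * p * \<rho>) \<le> sqrt ((2 * b) * \<eta>\<^sup>2)"
    by (intro real_sqrt_le_mono) (simp add: power2_eq_square mult_ac)
  also have "\<dots> = sqrt (2 * b) * \<eta>" using \<eta> by (simp add: real_sqrt_mult)
  finally have root: "sqrt (\<eta> * real n * p * \<rho>) \<le> sqrt (2 * b) * \<eta>" .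
  have "\<rho> * sqrt (\<eta> * real n * p * \<rho>) / (p * sqrt (real L)) \<le> \<rho> * (sqrt (2 * b) * \<eta>) / (p * sqrt (real L))"
    using root params by (intro divide_right_mono mult_left_mono) auto
  also have "\<dots> = sqrt (2 * b) * (\<rho> * \<eta> / (p * sqrt (real L)))" by simp
  finally have "\<rho> * \<eta> / (p * sqrt (real L)) + \<rho> * sqrt (\<eta> * real n * p * \<rho>) / (p * sqrt (real L))
      \<le> (1 + sqrt (2 * b)) * (\<rho> * \<eta> / (p * sqrt (real L)))"
    unfolding distrib_right mult_1 by (rule add_left_mono)
  also have "\<dots> \<le> (1 + sqrt (2 * b)) * (\<rho> * \<eta> / (p powr (3/2) * sqrt (real L)))"
  proof (intro mult_left_mono divide_left_mono mult_right_mono)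
    show "p powr (3/2) \<le> p" using powr_mono'[of 1 "3/2" p] params by simp
  qed (use params \<eta> b n0 in auto)
  finally show ?thesis by (simp only: \<eta>_def)
qed

text \<open>When \<open>n * p * \<rho> \<ge> a * \<eta>\<close>, \<eta> is at most a constant times
  \<open>sqrt (\<eta> * n * p * \<rho>)\<close>, so the cross terms govern the sum, and their rate
  is exactly the stated one.\<close>

lemma dense_rate_le:
  assumes a: "0 < a" and low: "a * ln (real L + real n) / (p * real n) \<le> \<rho>"
  shows "\<rho> * ln (real L + real n) / (p * sqrt (real L))
      + \<rho> * sqrt (ln (real L + real n) * real n * p * \<rho>) / (p * sqrt (real L))
    \<le> (1 + 1 / sqrt a) * (sqrt (real n) * \<rho> powr (3/2) * sqrt (ln (real L + real n)) / (sqrt p * sqrt (real L)))"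
proof -
  define \<eta> where "\<eta> = ln (real L + real n)"
  have \<eta>: "1 / 2 \<le> \<eta>" unfolding \<eta>_def by (rule ln_size_ge)
  have n0: "0 < real n" "0 < sqrt (real L)" using params by auto
  have low': "a * \<eta> \<le> real n * p * \<rho>"
    using low params n0 unfolding \<eta>_def[symmetric] by (simp add: field_simps)
  let ?t = "\<rho> * sqrt (\<eta> * real n * p * \<rho>) / (p * sqrt (real L))"
  have "\<rho> powr (3/2) = \<rho> powr (1 + 1/2)" by simp
  also have "\<dots> = \<rho> * sqrt \<rho>" using params by (simp only: powr_add) (simp add: powr_half_sqrt)
  finally have "sqrt (real n) * \<rho> powr (3/2) * sqrt \<eta> / (sqrt p * sqrt (real L))
      = \<rho> * (sqrt \<eta> * sqrt (real n) * sqrt \<rho>) / (sqrt p * sqrt (real L))" by simp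
  also have "\<dots> = \<rho> * (sqrt \<eta> * sqrt (real n) * sqrt p * sqrt \<rho>) / ((sqrt p * sqrt p) * sqrt (real L))"
    using params(3) by (simp add: field_simps del: real_sqrt_mult_self)
  also have "\<dots> = ?t" using params(3) by (simp add: real_sqrt_mult)
  finally have t: "sqrt (real n) * \<rho> powr (3/2) * sqrt \<eta> / (sqrt p * sqrt (real L)) = ?t" .
  have "\<eta> * (a * \<eta>) \<le> \<eta> * (real n * p * \<rho>)" using low' \<eta> by (intro mult_left_mono) auto
  then have "sqrt (a * \<eta>\<^sup>2) \<le> sqrt (\<eta> * real n * p * \<rho>)"
    by (intro real_sqrt_le_mono) (simp add: power2_eq_square mult_ac)
  then have "sqrt a * \<eta> \<le> sqrt (\<eta> * real n * p * \<rho>)" using \<eta> by (simp add: real_sqrt_mult)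
  then have "\<eta> \<le> 1 / sqrt a * sqrt (\<eta> * real n * p * \<rho>)" using a by (simp add: field_simps)
  then have "\<rho> * \<eta> / (p * sqrt (real L)) \<le> \<rho> * (1 / sqrt a * sqrt (\<eta> * real n * p * \<rho>)) / (p * sqrt (real L))"
    using params by (intro divide_right_mono mult_left_mono) auto
  also have "\<dots> = 1 / sqrt a * ?t" by simp
  finally have "\<rho> * \<eta> / (p * sqrt (real L)) + ?t \<le> (1 + 1 / sqrt a) * ?t" by (simp only: distrib_right mult_1)
  then show ?thesis unfolding t[symmetric] \<eta>_def[symmetric] by (simp only: t)
qed

end

theorem theorem2:
  fixes K :: nat and C0 :: real
  shows
   "(\<forall>a>0. \<forall>b>0. \<exists>c1>0. \<exists>C>0. \<exists>C'>0.
       \<forall>n L g B0 \<rho> p.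
         msbm_valid K C0 n L g B0 \<rho> p \<and>
         a * ln (real L + real n) / (p * real n * sqrt (real L)) \<le> \<rho> \<and>
         \<rho> \<le> b / (p * real n) \<longrightarrow>
         measure_pmf.prob (msbm_pmf n L g B0 \<rho> p)
           {\<omega>. spec_norm n (\<lambda>i j. Mbar n L p \<omega> i j - PiMat n L K g B0 \<rho> i j)
                 \<le> C * max (\<rho> * ln (real L + real n) / (p powr (3/2) * sqrt (real L))) (\<rho>\<^sup>2)}
         \<ge> 1 - C' * (real L + real n) powr (- c1))
    \<and>
    (\<forall>a>0. \<exists>c2>0. \<exists>C>0. \<exists>C'>0.
       \<forall>n L g B0 \<rho> p.
         msbm_valid K C0 n L g B0 \<rho> p \<and>
         a * ln (real L + real n) / (p * real n) \<le> \<rho> \<longrightarrow>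
         measure_pmf.prob (msbm_pmf n L g B0 \<rho> p)
           {\<omega>. spec_norm n (\<lambda>i j. Mbar n L p \<omega> i j - PiMat n L K g B0 \<rho> i j)
                 \<le> C * max (sqrt (real n) * \<rho> powr (3/2) * sqrt (ln (real L + real n))
                              / (sqrt p * sqrt (real L))) (\<rho>\<^sup>2)}
         \<ge> 1 - C' * (real L + real n) powr (- c2))"
proof (intro conjI allI impI)
  fix a b :: real assume a: "0 < a" and b: "0 < b"
  let ?C = "exp 2 * 87 * (1 + 3 / a) * (max 1 C0)\<^sup>2 * ((1 + sqrt (2 * b)) + 1)"
  have "0 < ?C" using a b by (intro mult_pos_pos add_pos_nonneg) auto
  moreover have "1 - 2 * (real L + real n) powr - 2 \<le> measure_pmf.prob (msbm_pmf n L g B0 \<rho> p)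
      {\<omega>. spec_norm n (\<lambda>i j. Mbar n L p \<omega> i j - PiMat n L K g B0 \<rho> i j)
        \<le> ?C * max (\<rho> * ln (real L + real n) / (p powr (3/2) * sqrt (real L))) (\<rho>\<^sup>2)}"
    if H: "msbm_valid K C0 n L g B0 \<rho> p" "a * ln (real L + real n) / (p * real n * sqrt (real L)) \<le> \<rho>"
      "\<rho> \<le> b / (p * real n)" for n L g B0 \<rho> p
  proof -
    interpret msbm K C0 n L g B0 \<rho> p by unfold_locales (rule H(1))
    have "0 < p * real n * sqrt (real L)" using params by simp
    then have "a * ln (real L + real n) \<le> real n * p * \<rho> * sqrt (real L)"
      using H(2) by (simp add: divide_le_eq mult_ac)
    then show ?thesis
      unfolding C_def[symmetric]
      using a b by (intro prob_spec_norm_error_le sparse_rate_le H(3)) auto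
  qed
  ultimately show "\<exists>c1>0. \<exists>C>0. \<exists>C'>0.
       \<forall>n L g B0 \<rho> p.
         msbm_valid K C0 n L g B0 \<rho> p \<and>
         a * ln (real L + real n) / (p * real n * sqrt (real L)) \<le> \<rho> \<and>
         \<rho> \<le> b / (p * real n) \<longrightarrow>
         measure_pmf.prob (msbm_pmf n L g B0 \<rho> p)
           {\<omega>. spec_norm n (\<lambda>i j. Mbar n L p \<omega> i j - PiMat n L K g B0 \<rho> i j)
                 \<le> C * max (\<rho> * ln (real L + real n) / (p powr (3/2) * sqrt (real L))) (\<rho>\<^sup>2)}
         \<ge> 1 - C' * (real L + real n) powr (- c1)"
    by (intro exI[of _ "2 :: real"] exI[of _ ?C] conjI allI impI) auto
next
  fix a :: real assume a: "0 < a"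
  let ?C = "exp 2 * 87 * (1 + 3 / a) * (max 1 C0)\<^sup>2 * ((1 + 1 / sqrt a) + 1)"
  have "0 < ?C" using a by (intro mult_pos_pos add_pos_nonneg) auto
  moreover have "1 - 2 * (real L + real n) powr - 2 \<le> measure_pmf.prob (msbm_pmf n L g B0 \<rho> p)
      {\<omega>. spec_norm n (\<lambda>i j. Mbar n L p \<omega> i j - PiMat n L K g B0 \<rho> i j)
        \<le> ?C * max (sqrt (real n) * \<rho> powr (3/2) * sqrt (ln (real L + real n))
                              / (sqrt p * sqrt (real L))) (\<rho>\<^sup>2)}"
    if H: "msbm_valid K C0 n L g B0 \<rho> p" "a * ln (real L + real n) / (p * real n) \<le> \<rho>" for n L g B0 \<rho> p
  proof -
    interpret msbm K C0 n L g B0 \<rho> p by unfold_locales (rule H(1))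
    have "0 < p * real n" using params by simp
    then have "a * ln (real L + real n) \<le> real n * p * \<rho>"
      using H(2) by (simp add: divide_le_eq mult_ac)
    \<comment> \<open>In the dense regime the lower bound on \<rho> holds without the help of
      \<open>sqrt L\<close>, and \<open>1 \<le> L\<close> lets this factor be inserted.\<close>
    also have "\<dots> * 1 \<le> real n * p * \<rho> * sqrt (real L)"
      using params by (intro mult_left_mono) auto
    finally have "a * ln (real L + real n) \<le> real n * p * \<rho> * sqrt (real L)" by simp
    then show ?thesis
      unfolding C_def[symmetric]
      using a by (intro prob_spec_norm_error_le dense_rate_le H(2)) auto
  qed
  ultimately show "\<exists>c2>0. \<exists>C>0. \<exists>C'>0.
       \<forall>n L g B0 \<rho> p.
         msbm_valid K C0 n L g B0 \<rho> p \<and>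
         a * ln (real L + real n) / (p * real n) \<le> \<rho> \<longrightarrow>
         measure_pmf.prob (msbm_pmf n L g B0 \<rho> p)
           {\<omega>. spec_norm n (\<lambda>i j. Mbar n L p \<omega> i j - PiMat n L K g B0 \<rho> i j)
                 \<le> C * max (sqrt (real n) * \<rho> powr (3/2) * sqrt (ln (real L + real n))
                              / (sqrt p * sqrt (real L))) (\<rho>\<^sup>2)}
         \<ge> 1 - C' * (real L + real n) powr (- c2)"
    by (intro exI[of _ "2 :: real"] exI[of _ ?C] conjI allI impI) auto
qed

end
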